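(* Let $X$ be a locally compact non-compact abelian group and let $\mathscr H,\mathscr K$ be Banach $X$-modules over the group $X$. If $T\in C^{\rm u}(Q;\mathscr H,\mathscr K)$ then $T$ is decay preserving.
   Context: Let $X^*$ be the dual group of $X$. A Banach $X$-module over the group $X$ is a Banach space $\mathscr H$ equipped with a strongly continuous representation $\{V_k\}_{k\in X^*}$ of $X^*$ on $\mathscr H$ (the same notation $V_k$ is used in different modules). Haar measures $dx$ on $X$ and $dk$ on $X^*$ are normalized so that, with $\widehat\varphi(k)=\int_X\overline{k(x)}\varphi(x)dx$, one has $\varphi(x)=\int_{X^*}k(x)\widehat\varphi(k)dk$. Let $C^{(a)}(X)$ be the set of functions $\varphi$ on $X$ whose Fourier transform $\widehat\varphi$ is an integrable function with compact support on $X^*$. For $\varphi\in C^{(a)}(X)$ set $\varphi(Q)=\int_{X^*}\widehat\varphi(k)V_k\,dk\in\mathcal B(\mathscr H)$. The multiplier algebra $\mathcal M(\mathscr H)$ is the norm closure of $\{\varphi(Q):\varphi\in C^{(a)}(X)\}$ in $\mathcal B(\mathscr H)$. $C^{\rm u}(Q;\mathscr H,\mathscr K)$ is the set of $T\in\mathcal B(\mathscr H,\mathscr K)$ such that the map $k\mapsto V_k^{-1}TV_k\in\mathcal B(\mathscr H,\mathscr K)$ is norm continuous on $X^*$. $\mathcal B_0^{\,l}(\mathscr H,\mathscr K)$ (resp. $\mathcal B_0^{\,r}(\mathscr H,\mathscr K)$) is the norm-closed linear span of the operators $NR$ with $N\in\mathcal M(\mathscr K)$ (resp. $RM$ with $M\in\mathcal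 M(\mathscr H)$), $R\in\mathcal B(\mathscr H,\mathscr K)$. $T$ is decay preserving if $TM\in\mathcal B_0^{\,l}(\mathscr H,\mathscr K)$ for every $M\in\mathcal M(\mathscr H)$ and $NT\in\mathcal B_0^{\,r}(\mathscr H,\mathscr K)$ for every $N\in\mathcal M(\mathscr K)$. *)

theory Defs
  imports "HOL-Analysis.Analysis"
begin

section \<open>Complex Banach spaces and bounded operators\<close>

class scaleC =
  fixes scaleC :: "complex \<Rightarrow> 'a \<Rightarrow> 'a"  (infixr \<open>*\<^sub>C\<close> 75)

class complex_normed_vector = real_normed_vector + scaleC +
  assumes scaleC_add_right: "c *\<^sub>C (u + v) = c *\<^sub>C u + c *\<^sub>C v"
    and scaleC_add_left: "(c + d) *\<^sub>C u = c *\<^sub>C u + d *\<^sub>C u"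
    and scaleC_scaleC: "c *\<^sub>C (d *\<^sub>C u) = (c * d) *\<^sub>C u"
    and scaleC_of_real: "complex_of_real r *\<^sub>C u = r *\<^sub>R u"
    and norm_scaleC: "norm (c *\<^sub>C u) = cmod c * norm u"

class complex_banach = complex_normed_vector + complete_space

instance complex_banach \<subseteq> banach ..

lemma scaleC_one: "1 *\<^sub>C u = (u :: 'a::complex_normed_vector)"
  using scaleC_of_real[of 1 u] by simp

instantiation complex :: complex_banach
begin
definition scaleC_complex :: "complex \<Rightarrow> complex \<Rightarrow> complex" where
  "scaleC_complex c z = c * z"
instance
  by standard (auto simp: scaleC_complex_def algebra_simps norm_mult scaleR_conv_of_real)
end

global_interpretation complex_vector:
  vector_space "scaleC :: complex \<Rightarrow> 'a \<Rightarrow> 'a::complex_normed_vector"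
  defines cspan = complex_vector.span
  by standard (simp_all add: scaleC_add_right scaleC_add_left scaleC_scaleC scaleC_one)

lemma bounded_linear_scaleC: "bounded_linear (\<lambda>u :: 'a::complex_normed_vector. c *\<^sub>C u)"
proof (rule bounded_linear_intro[where K = "cmod c"])
  fix r :: real and u :: 'a
  show "c *\<^sub>C r *\<^sub>R u = r *\<^sub>R c *\<^sub>C u"
    by (metis scaleC_of_real scaleC_scaleC mult.commute)
qed (simp_all add: scaleC_add_right norm_scaleC mult.commute)

instantiation blinfun :: (real_normed_vector, complex_normed_vector) complex_normed_vector
begin

lift_definition scaleC_blinfun :: "complex \<Rightarrow> ('a \<Rightarrow>\<^sub>L 'b) \<Rightarrow> 'a \<Rightarrow>\<^sub>L 'b"
  is "\<lambda>c f u. c *\<^sub>C f u"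
  by (rule bounded_linear_compose[OF bounded_linear_scaleC])

instance
proof
  fix c d :: complex and r :: real and f g :: "'a \<Rightarrow>\<^sub>L 'b"
  show "c *\<^sub>C (f + g) = c *\<^sub>C f + c *\<^sub>C g"
    by transfer (simp add: scaleC_add_right)
  show "(c + d) *\<^sub>C f = c *\<^sub>C f + d *\<^sub>C f"
    by transfer (simp add: scaleC_add_left)
  show comp: "c *\<^sub>C d *\<^sub>C f = (c * d) *\<^sub>C f" for c d and f :: "'a \<Rightarrow>\<^sub>L 'b"
    by transfer (simp add: scaleC_scaleC)
  show "complex_of_real r *\<^sub>C f = r *\<^sub>R f"
    by transfer (simp add: scaleC_of_real)
  have le: "norm (c *\<^sub>C f) \<le> cmod c * norm f" for c and f :: "'a \<Rightarrow>\<^sub>L 'b"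
    by (rule norm_blinfun_bound)
       (auto simp: scaleC_blinfun.rep_eq norm_scaleC mult.assoc intro!: mult_left_mono norm_blinfun)
  show "norm (c *\<^sub>C f) = cmod c * norm f"
  proof (cases "c = 0")
    case True
    with le[of 0 f] show ?thesis by simp
  next
    case False
    have "inverse c *\<^sub>C c *\<^sub>C f = f"
      using False by transfer (simp add: scaleC_scaleC scaleC_one)
    then have "norm f \<le> inverse (cmod c) * norm (c *\<^sub>C f)"
      using le[of "inverse c" "c *\<^sub>C f"] by (simp only: norm_inverse)
    then have "cmod c * norm f \<le> cmod c * (inverse (cmod c) * norm (c *\<^sub>C f))"
      by (rule mult_left_mono) simp
    also have "\<dots> = norm (c *\<^sub>C f)"
      using False by simp
    finally have "cmod c * norm f \<le> norm (c *\<^sub>C f)" .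
    with le[of c f] show ?thesis by simp
  qed
qed

end

text \<open>The space of bounded complex-linear operators.  The type \<open>'h \<Rightarrow>\<^sub>L 'k\<close> consists of the bounded
  real-linear maps; its norm is the operator norm.\<close>

definition bounded_ops :: "('h::complex_banach \<Rightarrow>\<^sub>L 'k::complex_banach) set" where
  "bounded_ops = {T. \<forall>c u. blinfun_apply T (c *\<^sub>C u) = c *\<^sub>C blinfun_apply T u}"


section \<open>The dual group\<close>

typedef (overloaded) ('x :: topological_ab_group_add) dual_group =
  "{k :: 'x \<Rightarrow> complex. continuous_on UNIV k \<and> (\<forall>x. cmod (k x) = 1) \<and>
      (\<forall>x y. k (x + y) = k x * k y)}"
  morphisms char_of Abs_dual_group
  by (rule exI[of _ "\<lambda>_. 1"]) auto

setup_lifting type_definition_dual_group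

lemma continuous_char: "continuous_on UNIV (char_of k)"
  and norm_char: "cmod (char_of k x) = 1"
  and char_add_arg: "char_of k (x + y) = char_of k x * char_of k y"
  using char_of[of k] by auto

lemma dual_group_eqI: "(\<And>x. char_of k x = char_of l x) \<Longrightarrow> k = l"
  by (metis char_of_inject ext)

text \<open>The dual group is written additively: \<open>k + l\<close> is the pointwise product of characters.\<close>

instantiation dual_group :: (topological_ab_group_add) ab_group_add
begin

lift_definition zero_dual_group :: "'a dual_group" is "\<lambda>_. 1" by auto

lift_definition plus_dual_group :: "'a dual_group \<Rightarrow> 'a dual_group \<Rightarrow> 'a dual_group"
  is "\<lambda>k l x. k x * l x"
  by (auto simp: norm_mult intro: continuous_on_mult)

lift_definition uminus_dual_group :: "'a dual_group \<Rightarrow> 'a dual_group"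
  is "\<lambda>k x. cnj (k x)"
  by (auto intro: continuous_on_cnj)

definition minus_dual_group :: "'a dual_group \<Rightarrow> 'a dual_group \<Rightarrow> 'a dual_group" where
  "minus_dual_group k l = k + - l"

instance
proof
  fix k l m :: "'a dual_group"
  show "k + l + m = k + (l + m)" by transfer (simp add: mult.assoc)
  show "k + l = l + k" by transfer (simp add: mult.commute)
  show "0 + k = k" by transfer simp
  show "- k + k = 0"
    by transfer (auto simp: fun_eq_iff mult.commute[of "cnj _"] complex_norm_square[symmetric])
  show "k - l = k + - l" by (rule minus_dual_group_def)
qed

end

text \<open>Topology of uniform convergence on compact sets.\<close>

instantiation dual_group :: (topological_ab_group_add) topological_space
begin

definition open_dual_group :: "'a dual_group set \<Rightarrow> bool" where
  "open_dual_group U \<longleftrightarrow> (\<forall>k\<in>U. \<exists>C e. compact C \<and> e > 0 \<and>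
     {l. \<forall>x\<in>C. dist (char_of l x) (char_of k x) < e} \<subseteq> U)"

instance
proof
  show "open (UNIV :: 'a dual_group set)"
    unfolding open_dual_group_def
    by (intro ballI exI[of _ "{}"] exI[of _ "1::real"]) simp
next
  fix S T :: "'a dual_group set"
  assume S: "open S" and T: "open T"
  show "open (S \<inter> T)"
    unfolding open_dual_group_def
  proof
    fix k assume k: "k \<in> S \<inter> T"
    have "\<exists>C e. compact C \<and> e > 0 \<and> {l. \<forall>x\<in>C. dist (char_of l x) (char_of k x) < e} \<subseteq> S"
      using S unfolding open_dual_group_def by (rule bspec) (use k in simp)
    then obtain C e where 1: "compact C" "e > 0" "{l. \<forall>x\<in>C. dist (char_of l x) (char_of k x) < e} \<subseteq> S"
      by (elim exE conjE)
    have "\<exists>C e. compact C \<and> e > 0 \<and> {l. \<forall>x\<in>C. dist (char_of l x) (char_of k x) < e} \<subseteq> T"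
      using T unfolding open_dual_group_def by (rule bspec) (use k in simp)
    then obtain D d where 2: "compact D" "d > 0" "{l. \<forall>x\<in>D. dist (char_of l x) (char_of k x) < d} \<subseteq> T"
      by (elim exE conjE)
    show "\<exists>C e. compact C \<and> e > 0 \<and>
        {l. \<forall>x\<in>C. dist (char_of l x) (char_of k x) < e} \<subseteq> S \<inter> T"
    proof (intro exI conjI)
      show "compact (C \<union> D)" "min e d > 0" using 1 2 by (simp_all add: compact_Un)
      show "{l. \<forall>x\<in>C \<union> D. dist (char_of l x) (char_of k x) < min e d} \<subseteq> S \<inter> T"
        using 1(3) 2(3) by (simp add: subset_iff)
    qed
  qed
next
  fix \<S> :: "'a dual_group set set"
  assume *: "\<forall>S\<in>\<S>. open S"
  show "open (\<Union>\<S>)"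
    unfolding open_dual_group_def
  proof
    fix k assume "k \<in> \<Union>\<S>"
    then obtain S where S: "S \<in> \<S>" "k \<in> S" by blast
    from * S(1) have "open S" by (rule bspec)
    then have "\<exists>C e. compact C \<and> e > 0 \<and> {l. \<forall>x\<in>C. dist (char_of l x) (char_of k x) < e} \<subseteq> S"
      unfolding open_dual_group_def using S(2) by (rule bspec)
    then obtain C e where C: "compact C" "e > 0"
      "{l. \<forall>x\<in>C. dist (char_of l x) (char_of k x) < e} \<subseteq> S"
      by (elim exE conjE)
    have "{l. \<forall>x\<in>C. dist (char_of l x) (char_of k x) < e} \<subseteq> \<Union>\<S>"
      using C(3) Union_upper[OF S(1)] by (rule order_trans)
    with C(1,2) show "\<exists>C e. compact C \<and> e > 0 \<and>
        {l. \<forall>x\<in>C. dist (char_of l x) (char_of k x) < e} \<subseteq> \<Union>\<S>"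
      by (intro exI[of _ C] exI[of _ e] conjI)
  qed
qed

end

lemma eventually_nhds_dual_group:
  "eventually P (nhds k) \<longleftrightarrow>
    (\<exists>C e. compact C \<and> e > 0 \<and> (\<forall>l. (\<forall>x\<in>C. dist (char_of l x) (char_of k x) < e) \<longrightarrow> P l))"
proof
  assume "eventually P (nhds k)"
  then obtain S where "open S" and k: "k \<in> S" and S: "\<forall>l\<in>S. P l"
    unfolding eventually_nhds by (elim exE conjE)
  have "\<exists>C e. compact C \<and> e > 0 \<and> {l. \<forall>x\<in>C. dist (char_of l x) (char_of k x) < e} \<subseteq> S"
    using \<open>open S\<close> k unfolding open_dual_group_def by (rule bspec)
  then obtain C e where C: "compact C" "e > 0"
      and sub: "{l. \<forall>x\<in>C. dist (char_of l x) (char_of k x) < e} \<subseteq> S"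
    by (elim exE conjE)
  have "\<forall>l. (\<forall>x\<in>C. dist (char_of l x) (char_of k x) < e) \<longrightarrow> P l"
    using sub S by (simp only: subset_eq mem_Collect_eq) simp
  with C show "\<exists>C e. compact C \<and> e > 0 \<and>
      (\<forall>l. (\<forall>x\<in>C. dist (char_of l x) (char_of k x) < e) \<longrightarrow> P l)"
    by (intro exI[of _ C] exI[of _ e] conjI)
next
  assume "\<exists>C e. compact C \<and> e > 0 \<and> (\<forall>l. (\<forall>x\<in>C. dist (char_of l x) (char_of k x) < e) \<longrightarrow> P l)"
  then obtain C e where C: "compact C" "e > 0"
    and P: "\<And>l. (\<forall>x\<in>C. dist (char_of l x) (char_of k x) < e) \<Longrightarrow> P l" by blast
  define S where "S = {l. \<exists>d<e. \<forall>x\<in>C. dist (char_of l x) (char_of k x) \<le> d}"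
  have "open S"
    unfolding open_dual_group_def
  proof
    fix l assume "l \<in> S"
    then obtain d where d: "d < e" "\<forall>x\<in>C. dist (char_of l x) (char_of k x) \<le> d"
      unfolding S_def by blast
    have "{m. \<forall>x\<in>C. dist (char_of m x) (char_of l x) < (e - d) / 2} \<subseteq> S"
      unfolding S_def
    proof clarify
      fix m assume m: "\<forall>x\<in>C. dist (char_of m x) (char_of l x) < (e - d) / 2"
      have "dist (char_of m x) (char_of k x) \<le> (e + d) / 2" if "x \<in> C" for x
      proof -
        have "dist (char_of m x) (char_of k x) \<le>
            dist (char_of m x) (char_of l x) + dist (char_of l x) (char_of k x)"
          by (rule dist_triangle)
        also have "\<dots> \<le> (e - d) / 2 + d"
          using m d that by (intro add_mono) (auto intro: less_imp_le)
        finally show ?thesis by (simp add: field_simps)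
      qed
      then show "\<exists>d<e. \<forall>x\<in>C. dist (char_of m x) (char_of k x) \<le> d"
        using d by (intro exI[of _ "(e + d) / 2"]) auto
    qed
    then show "\<exists>C e. compact C \<and> e > 0 \<and>
        {m. \<forall>x\<in>C. dist (char_of m x) (char_of l x) < e} \<subseteq> S"
      using C d by (intro exI[of _ C] exI[of _ "(e - d) / 2"]) auto
  qed
  moreover have "k \<in> S"
    unfolding S_def using C by (auto intro: exI[of _ 0])
  moreover have "\<forall>l\<in>S. P l"
    unfolding S_def by (auto intro!: P intro: le_less_trans)
  ultimately show "eventually P (nhds k)"
    unfolding eventually_nhds by blast
qed

lemma eventually_nhds_uniform_dual_group:
  assumes "compact C" "e > 0"
  shows "eventually (\<lambda>l. \<forall>x\<in>C. dist (char_of l x) (char_of k x) < e) (nhds k)"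
  using assms unfolding eventually_nhds_dual_group by blast

instance dual_group :: (topological_ab_group_add) topological_ab_group_add
proof
  fix a b :: "'a dual_group"
  show "((\<lambda>p. fst p + snd p) \<longlongrightarrow> a + b) (nhds a \<times>\<^sub>F nhds b)"
    unfolding filterlim_iff
  proof (intro allI impI)
    fix P assume "eventually P (nhds (a + b))"
    then obtain C e where C: "compact C" "e > 0"
      and P: "\<And>l. (\<forall>x\<in>C. dist (char_of l x) (char_of (a + b) x) < e) \<Longrightarrow> P l"
      unfolding eventually_nhds_dual_group by blast
    have "P (k + l)"
      if k: "\<forall>x\<in>C. dist (char_of k x) (char_of a x) < e / 2"
        and l: "\<forall>x\<in>C. dist (char_of l x) (char_of b x) < e / 2" for k l
    proof (rule P, rule)
      fix x assume x: "x \<in> C"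
      have "char_of k x * char_of l x - char_of a x * char_of b x =
          (char_of k x - char_of a x) * char_of l x + char_of a x * (char_of l x - char_of b x)"
        by (simp add: algebra_simps)
      then have "dist (char_of k x * char_of l x) (char_of a x * char_of b x)
          \<le> cmod ((char_of k x - char_of a x) * char_of l x)
            + cmod (char_of a x * (char_of l x - char_of b x))"
        by (simp only: dist_norm norm_triangle_ineq)
      also have "\<dots> = dist (char_of k x) (char_of a x) + dist (char_of l x) (char_of b x)"
        by (simp add: norm_mult norm_char dist_norm)
      also have "\<dots> < e" using k l x by fastforce
      finally show "dist (char_of (k + l) x) (char_of (a + b) x) < e"
        by (simp add: plus_dual_group.rep_eq)
    qed
    moreover have "eventually (\<lambda>k. \<forall>x\<in>C. dist (char_of k x) (char_of a x) < e / 2) (nhds a)"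
      and "eventually (\<lambda>k. \<forall>x\<in>C. dist (char_of k x) (char_of b x) < e / 2) (nhds b)"
      using C by (intro eventually_nhds_uniform_dual_group; simp)+
    ultimately show "eventually (\<lambda>p. P (fst p + snd p)) (nhds a \<times>\<^sub>F nhds b)"
      unfolding eventually_prod_filter fst_conv snd_conv by blast
  qed
  show "(uminus \<longlongrightarrow> - a) (nhds a)"
    unfolding filterlim_iff
  proof (intro allI impI)
    fix P assume "eventually P (nhds (- a))"
    then obtain C e where C: "compact C" "e > 0"
      and P: "\<And>l. (\<forall>x\<in>C. dist (char_of l x) (char_of (- a) x) < e) \<Longrightarrow> P l"
      unfolding eventually_nhds_dual_group by blast
    have "dist (char_of (- k) x) (char_of (- a) x) = dist (char_of k x) (char_of a x)" for k x
      unfolding uminus_dual_group.rep_eq dist_norm complex_cnj_diff[symmetric] complex_mod_cnj ..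
    then have "\<forall>k. (\<forall>x\<in>C. dist (char_of k x) (char_of a x) < e) \<longrightarrow> P (- k)"
      using P by simp
    with C show "eventually (\<lambda>k. P (- k)) (nhds a)"
      unfolding eventually_nhds_dual_group by blast
  qed
qed

instance dual_group :: (topological_ab_group_add) t2_space
proof
  fix k l :: "'a dual_group"
  assume "k \<noteq> l"
  then obtain x where x: "char_of k x \<noteq> char_of l x"
    using dual_group_eqI by blast
  define e where "e = dist (char_of k x) (char_of l x) / 2"
  have e: "e > 0" using x by (simp add: e_def)
  have "eventually (\<lambda>m. \<forall>y\<in>{x}. dist (char_of m y) (char_of k y) < e) (nhds k)"
    "eventually (\<lambda>m. \<forall>y\<in>{x}. dist (char_of m y) (char_of l y) < e) (nhds l)"
    using e by (auto intro!: eventually_nhds_uniform_dual_group simp del: ball_simps)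
  then have "\<exists>U. open U \<and> k \<in> U \<and> (\<forall>m\<in>U. dist (char_of m x) (char_of k x) < e)"
    "\<exists>V. open V \<and> l \<in> V \<and> (\<forall>m\<in>V. dist (char_of m x) (char_of l x) < e)"
    by (simp_all add: eventually_nhds)
  then obtain U V where "open U" "k \<in> U" "open V" "l \<in> V"
    and U: "\<forall>m\<in>U. dist (char_of m x) (char_of k x) < e"
    and V: "\<forall>m\<in>V. dist (char_of m x) (char_of l x) < e"
    by (elim exE conjE)
  moreover have "U \<inter> V = {}"
  proof (rule ccontr)
    assume "U \<inter> V \<noteq> {}"
    then obtain m where "m \<in> U" "m \<in> V" by blast
    then have "dist (char_of k x) (char_of l x) < e + e"
      using U V by (intro dist_triangle_less_add[of _ "char_of m x"]) (auto simp: dist_commute)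
    then show False by (simp add: e_def)
  qed
  ultimately show "\<exists>U V. open U \<and> open V \<and> k \<in> U \<and> l \<in> V \<and> U \<inter> V = {}" by blast
qed


section \<open>Haar measures and the Fourier transform\<close>

definition haar_measure :: "'g::{topological_ab_group_add, t2_space} measure \<Rightarrow> bool" where
  "haar_measure M \<longleftrightarrow>
     sets M = sets borel \<and>
     emeasure M UNIV \<noteq> 0 \<and>
     (\<forall>x. \<forall>A\<in>sets borel. emeasure M ((+) x ` A) = emeasure M A) \<and>
     (\<forall>C. compact C \<longrightarrow> emeasure M C < \<infinity>) \<and>
     (\<forall>A\<in>sets borel. emeasure M A = (INF U\<in>{U. open U \<and> A \<subseteq> U}. emeasure M U)) \<and>
     (\<forall>U. open U \<longrightarrow> emeasure M U = (SUP C\<in>{C. compact C \<and> C \<subseteq> U}. emeasure M C))"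

definition fourier_integral ::
  "'x::topological_ab_group_add measure \<Rightarrow> ('x \<Rightarrow> complex) \<Rightarrow> 'x dual_group \<Rightarrow> complex" where
  "fourier_integral \<mu> \<phi> k = (\<integral>x. cnj (char_of k x) * \<phi> x \<partial>\<mu>)"

definition inverse_fourier_integral ::
  "'x::topological_ab_group_add dual_group measure \<Rightarrow> ('x dual_group \<Rightarrow> complex) \<Rightarrow> 'x \<Rightarrow> complex" where
  "inverse_fourier_integral \<nu> \<psi> x = (\<integral>k. char_of k x * \<psi> k \<partial>\<nu>)"

definition fourier_normalized ::
  "'x::topological_ab_group_add measure \<Rightarrow> 'x dual_group measure \<Rightarrow> bool" where
  "fourier_normalized \<mu> \<nu> \<longleftrightarrow>
     (\<forall>\<phi>. continuous_on UNIV \<phi> \<and> integrable \<mu> \<phi> \<and> integrable \<nu> (fourier_integral \<mu> \<phi>) \<longrightarrow>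
        \<phi> = inverse_fourier_integral \<nu> (fourier_integral \<mu> \<phi>))"

text \<open>\<open>\<psi>\<close> is the Fourier transform of \<open>\<phi>\<close>.  For integrable \<open>\<phi>\<close> it is given by the Fourier integral.
  A function whose transform is integrable need not itself be integrable (on the real line,
  \<open>sin x / x\<close> has a transform proportional to the indicator of an interval, while the Bochner
  integral of the library would return the junk value 0); such a \<open>\<phi>\<close> is linked to its transform by
  the inversion formula.\<close>

definition has_fourier_transform ::
  "'x::topological_ab_group_add measure \<Rightarrow> 'x dual_group measure \<Rightarrow>
     ('x \<Rightarrow> complex) \<Rightarrow> ('x dual_group \<Rightarrow> complex) \<Rightarrow> bool" where
  "has_fourier_transform \<mu> \<nu> \<phi> \<psi> \<longleftrightarrow>
     integrable \<mu> \<phi> \<and> \<psi> = fourier_integral \<mu> \<phi> \<or>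
     integrable \<nu> \<psi> \<and> \<phi> = inverse_fourier_integral \<nu> \<psi>"

definition L1_compact_support ::
  "'g::topological_space measure \<Rightarrow> ('g \<Rightarrow> complex) set" where
  "L1_compact_support \<nu> = {\<psi>. integrable \<nu> \<psi> \<and> compact (closure {k. \<psi> k \<noteq> 0})}"

definition C_a ::
  "'x::topological_ab_group_add measure \<Rightarrow> 'x dual_group measure \<Rightarrow> ('x \<Rightarrow> complex) set" where
  "C_a \<mu> \<nu> = {\<phi>. \<exists>\<psi>\<in>L1_compact_support \<nu>. has_fourier_transform \<mu> \<nu> \<phi> \<psi>}"


section \<open>Banach modules over a group\<close>

definition banach_group_module ::
  "('x::topological_ab_group_add dual_group \<Rightarrow> 'h::complex_banach \<Rightarrow>\<^sub>L 'h) \<Rightarrow> bool" where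
  "banach_group_module V \<longleftrightarrow>
     range V \<subseteq> bounded_ops \<and>
     V 0 = id_blinfun \<and>
     (\<forall>k l. V (k + l) = V k o\<^sub>L V l) \<and>
     (\<forall>u. continuous_on UNIV (\<lambda>k. blinfun_apply (V k) u))"

text \<open>The Bochner integral.  This is \<^const>\<open>has_bochner_integral\<close> verbatim, except that the library
  version is restricted to second countable spaces and would thus exclude nonseparable modules.\<close>

definition has_vector_integral ::
  "'a measure \<Rightarrow> ('a \<Rightarrow> 'b::real_normed_vector) \<Rightarrow> 'b \<Rightarrow> bool" where
  "has_vector_integral M f v \<longleftrightarrow> f \<in> borel_measurable M \<and>
     (\<exists>s. (\<forall>i. Bochner_Integration.simple_bochner_integrable M (s i)) \<and>
          (\<lambda>i. \<integral>\<^sup>+x. norm (f x - s i x) \<partial>M) \<longlonglongrightarrow> 0 \<and>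
          (\<lambda>i. Bochner_Integration.simple_bochner_integral M (s i)) \<longlonglongrightarrow> v)"

text \<open>\<open>A = \<phi>(Q)\<close>.  As the representation is only strongly continuous, the operator-valued integral
  is understood pointwise on vectors.\<close>

definition is_function_of_Q ::
  "'x::topological_ab_group_add measure \<Rightarrow> 'x dual_group measure \<Rightarrow>
     ('x dual_group \<Rightarrow> 'h::complex_banach \<Rightarrow>\<^sub>L 'h) \<Rightarrow> ('x \<Rightarrow> complex) \<Rightarrow> ('h \<Rightarrow>\<^sub>L 'h) \<Rightarrow> bool" where
  "is_function_of_Q \<mu> \<nu> V \<phi> A \<longleftrightarrow>
     (\<exists>\<psi>\<in>L1_compact_support \<nu>. has_fourier_transform \<mu> \<nu> \<phi> \<psi> \<and>
        (\<forall>u. has_vector_integral \<nu> (\<lambda>k. \<psi> k *\<^sub>C blinfun_apply (V k) u) (blinfun_apply A u)))"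

definition multiplier_algebra ::
  "'x::topological_ab_group_add measure \<Rightarrow> 'x dual_group measure \<Rightarrow>
     ('x dual_group \<Rightarrow> 'h::complex_banach \<Rightarrow>\<^sub>L 'h) \<Rightarrow> ('h \<Rightarrow>\<^sub>L 'h) set" where
  "multiplier_algebra \<mu> \<nu> V =
     closure {A \<in> bounded_ops. \<exists>\<phi>\<in>C_a \<mu> \<nu>. is_function_of_Q \<mu> \<nu> V \<phi> A}"

text \<open>\<open>V (- k)\<close> is the inverse of \<open>V k\<close> in a Banach module.\<close>

definition Cu_Q ::
  "('x::topological_ab_group_add dual_group \<Rightarrow> 'h::complex_banach \<Rightarrow>\<^sub>L 'h) \<Rightarrow>
   ('x dual_group \<Rightarrow> 'k::complex_banach \<Rightarrow>\<^sub>L 'k) \<Rightarrow> ('h \<Rightarrow>\<^sub>L 'k) set" where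
  "Cu_Q V W = {T \<in> bounded_ops. continuous_on UNIV (\<lambda>k. W (- k) o\<^sub>L T o\<^sub>L V k)}"

definition B0_left ::
  "'x::topological_ab_group_add measure \<Rightarrow> 'x dual_group measure \<Rightarrow>
     ('x dual_group \<Rightarrow> 'k::complex_banach \<Rightarrow>\<^sub>L 'k) \<Rightarrow> ('h::complex_banach \<Rightarrow>\<^sub>L 'k) set" where
  "B0_left \<mu> \<nu> W =
     closure (cspan {N o\<^sub>L R | N R. N \<in> multiplier_algebra \<mu> \<nu> W \<and> R \<in> bounded_ops})"

definition B0_right ::
  "'x::topological_ab_group_add measure \<Rightarrow> 'x dual_group measure \<Rightarrow>
     ('x dual_group \<Rightarrow> 'h::complex_banach \<Rightarrow>\<^sub>L 'h) \<Rightarrow> ('h \<Rightarrow>\<^sub>L 'k::complex_banach) set" where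
  "B0_right \<mu> \<nu> V =
     closure (cspan {R o\<^sub>L M | R M. R \<in> bounded_ops \<and> M \<in> multiplier_algebra \<mu> \<nu> V})"

definition decay_preserving ::
  "'x::topological_ab_group_add measure \<Rightarrow> 'x dual_group measure \<Rightarrow>
     ('x dual_group \<Rightarrow> 'h::complex_banach \<Rightarrow>\<^sub>L 'h) \<Rightarrow>
     ('x dual_group \<Rightarrow> 'k::complex_banach \<Rightarrow>\<^sub>L 'k) \<Rightarrow> ('h \<Rightarrow>\<^sub>L 'k) \<Rightarrow> bool" where
  "decay_preserving \<mu> \<nu> V W T \<longleftrightarrow> T \<in> bounded_ops \<and>
     (\<forall>M\<in>multiplier_algebra \<mu> \<nu> V. T o\<^sub>L M \<in> B0_left \<mu> \<nu> W) \<and>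
     (\<forall>N\<in>multiplier_algebra \<mu> \<nu> W. N o\<^sub>L T \<in> B0_right \<mu> \<nu> V)"

end

theory Submission
  imports Defs
begin

text \<open>If \<open>\<psi>\<close> is the transform of \<open>\<phi>\<close>, then \<open>T \<phi>(Q) = \<integral> \<psi>(k) W\<^sub>k S\<^sub>k dk\<close> with the norm continuous function
  \<open>S\<^sub>k = W\<^sub>k\<inverse> T V\<^sub>k\<close>.  On the compact support of \<open>\<psi>\<close>, \<open>S\<close> is uniformly close to a step function with
  values \<open>S\<^sub>y\<close> on Borel sets \<open>B\<^sub>y\<close>, for finitely many points \<open>y\<close>, and \<open>\<parallel>W\<^sub>k\<parallel>\<close> is bounded there by the uniform boundedness
  principle, so \<open>T \<phi>(Q)\<close> is a norm limit of sums \<open>\<Sum>\<^sub>y \<phi>\<^sub>y(Q) S\<^sub>y\<close>, where \<open>\<phi>\<^sub>y\<close> has the transform \<open>1\<^bsub>B\<^sub>y\<^esub> \<psi>\<close>, which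
  is again integrable with compact support.  For \<open>\<phi>(Q) T\<close> one writes \<open>W\<^sub>k T = S\<^bsub>-k\<^esub> V\<^sub>k\<close> instead.\<close>

section \<open>Step functions on compact sets and uniform boundedness\<close>

text \<open>By compactness, finitely many of the open sets where \<open>g\<close> is
  \<open>e\<close>-close to \<open>g d\<close>, with \<open>d\<close> in \<open>K\<close>, cover
  \<open>K\<close>; on each of them \<open>h\<close> takes the value \<open>d\<close>. The step
  function is built in the domain rather than in the range of \<open>g\<close>, so each of its
  values is a point at which another function can be frozen, and values inside \<open>K\<close> make
  a bound of \<open>g\<close> on \<open>K\<close> a bound of \<open>g\<close> after \<open>h\<close>
  everywhere.\<close>

lemma finite_range_approximation_on_compact:
  fixes g :: "'g::topological_space \<Rightarrow> 'b::metric_space"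
  assumes K: "compact K" "K \<noteq> {}" and g: "continuous_on UNIV g"
    and M: "sets M = sets borel" and e: "0 < e"
  obtains h :: "'g \<Rightarrow> 'g" where "simple_function M h" "range h \<subseteq> K" "finite (range h)"
    "\<And>k. k \<in> K \<Longrightarrow> dist (g (h k)) (g k) < e"
proof -
  have spM: "space M = UNIV"
    using sets_eq_imp_space_eq[OF M] by simp
  define U where "U d = {l. dist (g d) (g l) < e}" for d
  have oU: "open (U d)" for d
    unfolding U_def by (intro open_Collect_less continuous_intros g)
  obtain k0 where k0: "k0 \<in> K" using K by auto
  have "K \<subseteq> (\<Union>d\<in>K. U d)" using e by (auto simp: U_def)
  then obtain D where D: "D \<subseteq> K" "finite D" "K \<subseteq> (\<Union>d\<in>D. U d)"
    using compactE_image[OF K(1), of K U] oU by metis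
  \<comment> \<open>Induction over the finite cover: a new set overrides the earlier choices, which
    is harmless because its own centre is close to every point in it. The point \<open>k0\<close> is
    the default value where no set of the cover applies.\<close>
  have "\<exists>h. simple_function M h \<and> range h \<subseteq> insert k0 D \<and> (\<forall>k\<in>(\<Union>d\<in>D. U d). dist (g (h k)) (g k) < e)"
    using D(2)
  proof (induction D)
    case empty
    show ?case by (rule exI[of _ "\<lambda>_. k0"]) auto
  next
    case (insert d D)
    then obtain h where h: "simple_function M h" "range h \<subseteq> insert k0 D"
      "\<forall>k\<in>(\<Union>d\<in>D. U d). dist (g (h k)) (g k) < e" by blast
    have "simple_function M (\<lambda>k. if k \<in> U d then d else h k)"
      using oU[of d] h(1) M by (intro simple_function_If_set) (auto simp: spM)
    moreover have "range (\<lambda>k. if k \<in> U d then d else h k) \<subseteq> insert k0 (insert d D)"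
      using h(2) by auto
    moreover have "\<forall>k\<in>(\<Union>d\<in>insert d D. U d). dist (g (if k \<in> U d then d else h k)) (g k) < e"
      using h(3) by (auto simp: U_def)
    ultimately show ?case by blast
  qed
  then obtain h where h: "simple_function M h" "range h \<subseteq> insert k0 D"
    "\<forall>k\<in>(\<Union>d\<in>D. U d). dist (g (h k)) (g k) < e" by blast
  show ?thesis
  proof (rule that[OF h(1)])
    show "range h \<subseteq> K" using h(2) D k0 by auto
    show "finite (range h)" using h(2) D(2) finite_subset by blast
    show "dist (g (h k)) (g k) < e" if "k \<in> K" for k using h(3) D(3) that by blast
  qed
qed

text \<open>Banach-Steinhaus by Baire category. The closed sets \<open>E n\<close> exhaust the
  space, so one of them contains a ball; any vector of length \<open>r\<close> is a difference of
  two points of that ball, hence is mapped to norm at most \<open>2 * n\<close> by all of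
  \<open>F\<close>.\<close>

lemma uniformly_bounded_of_pointwise_bounded:
  fixes F :: "('a::banach \<Rightarrow>\<^sub>L 'b::real_normed_vector) set"
  assumes bdd: "\<And>u. \<exists>B. \<forall>T\<in>F. norm (blinfun_apply T u) \<le> B"
  shows "\<exists>C\<ge>0. \<forall>T\<in>F. norm T \<le> C"
proof -
  define E where "E n = {u. \<forall>T\<in>F. norm (blinfun_apply T u) \<le> real n}" for n
  have clE: "closed (E n)" for n
  proof -
    have "E n = (\<Inter>T\<in>F. {u. norm (blinfun_apply T u) \<le> real n})" by (auto simp: E_def)
    then show ?thesis by (auto intro!: closed_INT closed_Collect_le continuous_intros)
  qed
  have "\<Union>(range E) = UNIV"
  proof -
    have "u \<in> \<Union>(range E)" for u
    proof -
      obtain B where B: "\<forall>T\<in>F. norm (blinfun_apply T u) \<le> B" using bdd by blast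
      obtain n where "B \<le> real n" using real_arch_simple by blast
      then have "u \<in> E n" using B unfolding E_def by (auto intro: order_trans)
      then show ?thesis by blast
    qed
    then show ?thesis by blast
  qed
  have "\<exists>n. interior (E n) \<noteq> {}"
  proof (rule ccontr)
    assume "\<not> (\<exists>n. interior (E n) \<noteq> {})"
    then have "euclidean interior_of \<Union>(range E) = {}"
      using clE completely_metrizable_space_euclidean[where 'a='a]
      by (intro Baire_category_alt) auto
    with \<open>\<Union>(range E) = UNIV\<close> show False by simp
  qed
  then obtain n x where "x \<in> interior (E n)" by blast
  then obtain r where r: "0 < r" "cball x r \<subseteq> E n"
    unfolding mem_interior_cball by blast
  have "norm T \<le> 2 * real n / r" if T: "T \<in> F" for T
  proof (rule norm_blinfun_bound)
    fix u
    show "norm (blinfun_apply T u) \<le> 2 * real n / r * norm u"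
    proof (cases "u = 0")
      case False
      \<comment> \<open>Rescaling to norm \<open>r\<close> puts both \<open>x\<close> and
        \<open>x + w\<close> into the ball.\<close>
      define w where "w = (r / norm u) *\<^sub>R u"
      have "norm w = r" using False r by (simp add: w_def)
      then have "x + w \<in> cball x r" "x \<in> cball x r" using r by (auto simp: dist_norm)
      then have b: "norm (blinfun_apply T (x + w)) \<le> n" "norm (blinfun_apply T x) \<le> n"
        using r T unfolding E_def by blast+
      have "norm (blinfun_apply T w) = norm (blinfun_apply T (x + w) - blinfun_apply T x)"
        by (simp add: blinfun.bilinear_simps)
      also have "\<dots> \<le> 2 * real n" using norm_triangle_ineq4 b by (smt (verit, best))
      finally have "r / norm u * norm (blinfun_apply T u) \<le> 2 * real n"
        using r by (simp add: w_def blinfun.bilinear_simps)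
      then show ?thesis using False r by (simp add: field_simps)
    qed simp
  qed (use r in auto)
  then show ?thesis using r by (intro exI[of _ "2 * real n / r"]) auto
qed

section \<open>Vector integrals controlled by measurable error bounds\<close>

text \<open>The sequence of error bounds \<open>H\<close> makes this an integral in the sense of the upper integral:
  unlike \<^const>\<open>has_vector_integral\<close> it does not ask for measurability, which sums of functions
  into a nonseparable space need not inherit.\<close>

definition has_L1_limit_integral :: "'a measure \<Rightarrow> ('a \<Rightarrow> 'b::real_normed_vector) \<Rightarrow> 'b \<Rightarrow> bool" where
  "has_L1_limit_integral M f v \<longleftrightarrow>
    (\<exists>s H. (\<forall>i. Bochner_Integration.simple_bochner_integrable M (s i)) \<and>
      (\<forall>i. H i \<in> borel_measurable M) \<and>
      (\<forall>i. \<forall>x\<in>space M. ennreal (norm (f x - s i x)) \<le> H i x) \<and>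
      (\<lambda>i. \<integral>\<^sup>+x. H i x \<partial>M) \<longlonglongrightarrow> 0 \<and>
      (\<lambda>i. Bochner_Integration.simple_bochner_integral M (s i)) \<longlonglongrightarrow> v)"

lemma has_L1_limit_integralI:
  assumes "\<And>i. Bochner_Integration.simple_bochner_integrable M (s i)"
    "\<And>i. H i \<in> borel_measurable M"
    "\<And>i x. x \<in> space M \<Longrightarrow> ennreal (norm (f x - s i x)) \<le> H i x"
    "(\<lambda>i. \<integral>\<^sup>+x. H i x \<partial>M) \<longlonglongrightarrow> 0"
    "(\<lambda>i. Bochner_Integration.simple_bochner_integral M (s i)) \<longlonglongrightarrow> v"
  shows "has_L1_limit_integral M f v"
  unfolding has_L1_limit_integral_def using assms by blast

lemma has_L1_limit_integralE:
  assumes "has_L1_limit_integral M f v"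
  obtains s H where "\<And>i. Bochner_Integration.simple_bochner_integrable M (s i)"
    "\<And>i. H i \<in> borel_measurable M"
    "\<And>i x. x \<in> space M \<Longrightarrow> ennreal (norm (f x - s i x)) \<le> H i x"
    "(\<lambda>i. \<integral>\<^sup>+x. H i x \<partial>M) \<longlonglongrightarrow> 0"
    "(\<lambda>i. Bochner_Integration.simple_bochner_integral M (s i)) \<longlonglongrightarrow> v"
  using assms unfolding has_L1_limit_integral_def by blast

lemma simple_bochner_integrable_imp_simple_function:
  "Bochner_Integration.simple_bochner_integrable M s \<Longrightarrow> simple_function M s"
  by (auto elim: simple_bochner_integrable.cases)

text \<open>The errors themselves serve as \<open>H\<close>. They are measurable because
  \<open>s i\<close> has finitely many values: on each level set the error is the norm of
  \<open>f\<close> minus a constant, a continuous function of \<open>f\<close>. This argument works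
  in nonseparable spaces.\<close>

lemma has_L1_limit_integral_of_has_vector_integral:
  fixes f :: "'a \<Rightarrow> 'b::real_normed_vector"
  assumes "has_vector_integral M f v"
  shows "has_L1_limit_integral M f v"
proof -
  obtain s where s: "f \<in> borel_measurable M"
    "\<And>i. Bochner_Integration.simple_bochner_integrable M (s i)"
    "(\<lambda>i. \<integral>\<^sup>+x. norm (f x - s i x) \<partial>M) \<longlonglongrightarrow> 0"
    "(\<lambda>i. Bochner_Integration.simple_bochner_integral M (s i)) \<longlonglongrightarrow> v"
    using assms unfolding has_vector_integral_def by blast
  have "(\<lambda>x. ennreal (norm (f x - s i x))) \<in> borel_measurable M" for i
  proof -
    have sf: "simple_function M (s i)"
      using s(2) by (rule simple_bochner_integrable_imp_simple_function)
    have "s i \<in> measurable M (count_space (s i ` space M))"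
      using sf by (auto simp: simple_function_def measurable_count_space_eq2 countable_finite)
    then have "(\<lambda>x. (\<lambda>y x. ennreal (norm (f x - y))) (s i x) x) \<in> borel_measurable M"
    proof (rule measurable_compose_countable'[rotated])
      show "countable (s i ` space M)"
        using sf by (simp add: simple_functionD countable_finite)
      fix y :: 'b
      have "(\<lambda>z. ennreal (norm (z - y))) \<in> borel_measurable borel"
        by (intro measurable_compose[OF _ measurable_ennreal] borel_measurable_continuous_onI
            continuous_intros)
      with s(1) show "(\<lambda>x. ennreal (norm (f x - y))) \<in> borel_measurable M"
        by (rule measurable_compose)
    qed
    then show ?thesis by simp
  qed
  then show ?thesis
    by (intro has_L1_limit_integralI[where s=s and H="\<lambda>i x. ennreal (norm (f x - s i x))"] s) auto
qed

text \<open>Monotonicity of the nonnegative integral squeezes the error integrals between 0 and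
  those of \<open>H\<close>.\<close>

lemma has_vector_integral_of_has_L1_limit_integral:
  assumes f: "f \<in> borel_measurable M" and "has_L1_limit_integral M f v"
  shows "has_vector_integral M f v"
proof -
  from assms(2) obtain s H where s: "\<And>i. Bochner_Integration.simple_bochner_integrable M (s i)"
    "\<And>i. H i \<in> borel_measurable M"
    "\<And>i x. x \<in> space M \<Longrightarrow> ennreal (norm (f x - s i x)) \<le> H i x"
    "(\<lambda>i. \<integral>\<^sup>+x. H i x \<partial>M) \<longlonglongrightarrow> 0"
    "(\<lambda>i. Bochner_Integration.simple_bochner_integral M (s i)) \<longlonglongrightarrow> v"
    by (rule has_L1_limit_integralE) blast
  have "(\<lambda>i. \<integral>\<^sup>+x. norm (f x - s i x) \<partial>M) \<longlonglongrightarrow> 0"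
    by (rule tendsto_sandwich[OF _ _ tendsto_const s(4)])
       (auto intro!: always_eventually nn_integral_mono s(3))
  then show ?thesis
    unfolding has_vector_integral_def using f s by blast
qed

text \<open>An operator bound \<open>B\<close> of \<open>L\<close> turns the error bounds
  \<open>H i\<close> into \<open>B * H i\<close>. This moves fixed operators under the integral
  sign.\<close>

lemma has_L1_limit_integral_bounded_linear:
  assumes L: "bounded_linear L" and f: "has_L1_limit_integral M f v"
  shows "has_L1_limit_integral M (\<lambda>x. L (f x)) (L v)"
proof -
  interpret L: bounded_linear L by fact
  obtain s H where s: "\<And>i. Bochner_Integration.simple_bochner_integrable M (s i)"
    "\<And>i. H i \<in> borel_measurable M"
    "\<And>i x. x \<in> space M \<Longrightarrow> ennreal (norm (f x - s i x)) \<le> H i x"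
    "(\<lambda>i. \<integral>\<^sup>+x. H i x \<partial>M) \<longlonglongrightarrow> 0"
    "(\<lambda>i. Bochner_Integration.simple_bochner_integral M (s i)) \<longlonglongrightarrow> v"
    using f by (rule has_L1_limit_integralE) blast
  obtain B where B: "\<And>x. norm (L x) \<le> norm x * B" "0 \<le> B" using L.nonneg_bounded by blast
  show ?thesis
  proof (rule has_L1_limit_integralI[where s="\<lambda>i x. L (s i x)" and H="\<lambda>i x. ennreal B * H i x"])
    fix i
    show "Bochner_Integration.simple_bochner_integrable M (\<lambda>x. L (s i x))"
      using simple_bochner_integrable_compose2[of "\<lambda>x y. L x", OF _ s(1) s(1)] by (simp add: L.zero)
    show "(\<lambda>x. ennreal B * H i x) \<in> borel_measurable M" using s(2) by measurable
    fix x assume x: "x \<in> space M"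
    have "ennreal (norm (L (f x) - L (s i x))) \<le> ennreal (B * norm (f x - s i x))"
      using B(1)[of "f x - s i x"] by (intro ennreal_leI) (simp add: L.diff mult.commute)
    also have "\<dots> = ennreal B * ennreal (norm (f x - s i x))"
      using B(2) by (simp add: ennreal_mult)
    also have "\<dots> \<le> ennreal B * H i x" by (intro mult_left_mono s(3) x) simp
    finally show "ennreal (norm (L (f x) - L (s i x))) \<le> ennreal B * H i x" .
  next
    have "(\<lambda>i. ennreal B * (\<integral>\<^sup>+x. H i x \<partial>M)) \<longlonglongrightarrow> ennreal B * 0"
      using s(4) by (intro ennreal_tendsto_cmult) simp_all
    then show "(\<lambda>i. \<integral>\<^sup>+x. ennreal B * H i x \<partial>M) \<longlonglongrightarrow> 0"
      using s(2) by (simp add: nn_integral_cmult)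
    have "Bochner_Integration.simple_bochner_integral M (\<lambda>x. L (s i x)) =
        L (Bochner_Integration.simple_bochner_integral M (s i))" for i
      by (rule simple_bochner_integral_linear[OF L.linear_axioms s(1)])
    then show "(\<lambda>i. Bochner_Integration.simple_bochner_integral M (\<lambda>x. L (s i x))) \<longlonglongrightarrow> L v"
      using L.tendsto[OF s(5)] by simp
  qed
qed

text \<open>The errors of the sums are dominated by \<open>H i + G i\<close>, and additivity of the
  integral is applied to these measurable bounds only, never to the norms of vector-valued
  sums.\<close>

lemma has_L1_limit_integral_add:
  assumes f: "has_L1_limit_integral M f v" and g: "has_L1_limit_integral M g w"
  shows "has_L1_limit_integral M (\<lambda>x. f x + g x) (v + w)"
proof -
  obtain s H where s: "\<And>i. Bochner_Integration.simple_bochner_integrable M (s i)"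
    "\<And>i. H i \<in> borel_measurable M"
    "\<And>i x. x \<in> space M \<Longrightarrow> ennreal (norm (f x - s i x)) \<le> H i x"
    "(\<lambda>i. \<integral>\<^sup>+x. H i x \<partial>M) \<longlonglongrightarrow> 0"
    "(\<lambda>i. Bochner_Integration.simple_bochner_integral M (s i)) \<longlonglongrightarrow> v"
    using f by (rule has_L1_limit_integralE) blast
  obtain t G where t: "\<And>i. Bochner_Integration.simple_bochner_integrable M (t i)"
    "\<And>i. G i \<in> borel_measurable M"
    "\<And>i x. x \<in> space M \<Longrightarrow> ennreal (norm (g x - t i x)) \<le> G i x"
    "(\<lambda>i. \<integral>\<^sup>+x. G i x \<partial>M) \<longlonglongrightarrow> 0"
    "(\<lambda>i. Bochner_Integration.simple_bochner_integral M (t i)) \<longlonglongrightarrow> w"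
    using g by (rule has_L1_limit_integralE) blast
  note [measurable] = s(2) t(2)
  show ?thesis
  proof (rule has_L1_limit_integralI[where s="\<lambda>i x. s i x + t i x" and H="\<lambda>i x. H i x + G i x"])
    fix i
    show "Bochner_Integration.simple_bochner_integrable M (\<lambda>x. s i x + t i x)"
      by (rule simple_bochner_integrable_compose2[OF _ s(1) t(1)]) simp
    show "(\<lambda>x. H i x + G i x) \<in> borel_measurable M" by measurable
    fix x assume x: "x \<in> space M"
    have "ennreal (norm (f x + g x - (s i x + t i x)))
        \<le> ennreal (norm (f x - s i x) + norm (g x - t i x))"
      by (intro ennreal_leI norm_diff_triangle_ineq)
    also have "\<dots> \<le> H i x + G i x" using s(3)[OF x] t(3)[OF x] by (simp add: add_mono)
    finally show "ennreal (norm (f x + g x - (s i x + t i x))) \<le> H i x + G i x" .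
  next
    have "(\<lambda>i. (\<integral>\<^sup>+x. H i x \<partial>M) + (\<integral>\<^sup>+x. G i x \<partial>M)) \<longlonglongrightarrow> 0 + 0"
      by (intro tendsto_add s(4) t(4))
    then show "(\<lambda>i. \<integral>\<^sup>+x. H i x + G i x \<partial>M) \<longlonglongrightarrow> 0"
      by (simp add: nn_integral_add)
    show "(\<lambda>i. Bochner_Integration.simple_bochner_integral M (\<lambda>x. s i x + t i x)) \<longlonglongrightarrow> v + w"
      using tendsto_add[OF s(5) t(5)] by (simp add: simple_bochner_integral_add s(1) t(1))
  qed
qed

lemma has_L1_limit_integral_diff:
  assumes "has_L1_limit_integral M f v" "has_L1_limit_integral M g w"
  shows "has_L1_limit_integral M (\<lambda>x. f x - g x) (v - w)"
  using has_L1_limit_integral_add[OF assms(1)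
      has_L1_limit_integral_bounded_linear[OF bounded_linear_minus[OF bounded_linear_ident] assms(2)]]
  by simp

lemma has_L1_limit_integral_zero: "has_L1_limit_integral M (\<lambda>_. 0) 0"
  by (rule has_L1_limit_integralI[where s="\<lambda>_ _. 0" and H="\<lambda>_ _. 0"])
     (auto simp: simple_bochner_integrable.simps simple_bochner_integral_def sum.neutral)

lemma has_L1_limit_integral_sum:
  assumes "\<And>i. i \<in> I \<Longrightarrow> has_L1_limit_integral M (f i) (v i)"
  shows "has_L1_limit_integral M (\<lambda>x. \<Sum>i\<in>I. f i x) (\<Sum>i\<in>I. v i)"
  using assms
  by (induction I rule: infinite_finite_induct)
     (auto simp: has_L1_limit_integral_zero intro!: has_L1_limit_integral_add)

lemma ennreal_norm_simple_bochner_integral_le: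
  assumes "Bochner_Integration.simple_bochner_integrable M s"
  shows "ennreal (norm (Bochner_Integration.simple_bochner_integral M s)) \<le> (\<integral>\<^sup>+x. norm (s x) \<partial>M)"
proof -
  have "ennreal (norm (Bochner_Integration.simple_bochner_integral M s))
      \<le> Bochner_Integration.simple_bochner_integral M (\<lambda>x. norm (s x))"
    by (intro ennreal_leI simple_bochner_integral_norm_bound assms)
  also have "\<dots> = (\<integral>\<^sup>+x. norm (s x) \<partial>M)"
    using simple_bochner_integrable_compose2[of "\<lambda>x y. norm x", OF _ assms assms]
    by (intro simple_bochner_integral_eq_nn_integral) auto
  finally show ?thesis .
qed

text \<open>Each approximant satisfies the bound up to the error: its norm is at most
  \<open>g + H i\<close>, so its integral has norm at most the integral of \<open>g\<close> plus a
  term that tends to 0.\<close>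

lemma has_L1_limit_integral_norm_bound:
  assumes f: "has_L1_limit_integral M f v" and g: "g \<in> borel_measurable M"
    and le: "\<And>x. x \<in> space M \<Longrightarrow> ennreal (norm (f x)) \<le> g x"
  shows "ennreal (norm v) \<le> (\<integral>\<^sup>+x. g x \<partial>M)"
proof -
  obtain s H where s: "\<And>i. Bochner_Integration.simple_bochner_integrable M (s i)"
    "\<And>i. H i \<in> borel_measurable M"
    "\<And>i x. x \<in> space M \<Longrightarrow> ennreal (norm (f x - s i x)) \<le> H i x"
    "(\<lambda>i. \<integral>\<^sup>+x. H i x \<partial>M) \<longlonglongrightarrow> 0"
    "(\<lambda>i. Bochner_Integration.simple_bochner_integral M (s i)) \<longlonglongrightarrow> v"
    using f by (rule has_L1_limit_integralE) blast
  have "ennreal (norm (Bochner_Integration.simple_bochner_integral M (s i)))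
      \<le> (\<integral>\<^sup>+x. g x \<partial>M) + (\<integral>\<^sup>+x. H i x \<partial>M)" for i
  proof -
    have "ennreal (norm (s i x)) \<le> g x + H i x" if x: "x \<in> space M" for x
    proof -
      have "ennreal (norm (s i x)) \<le> ennreal (norm (f x) + norm (f x - s i x))"
        using norm_triangle_sub[of "s i x" "f x"]
        by (intro ennreal_leI) (simp add: norm_minus_commute)
      also have "\<dots> \<le> g x + H i x" using le[OF x] s(3)[OF x] by (simp add: add_mono)
      finally show ?thesis .
    qed
    then have "(\<integral>\<^sup>+x. norm (s i x) \<partial>M) \<le> (\<integral>\<^sup>+x. g x + H i x \<partial>M)"
      by (intro nn_integral_mono)
    also have "\<dots> = (\<integral>\<^sup>+x. g x \<partial>M) + (\<integral>\<^sup>+x. H i x \<partial>M)"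
      using g s(2) by (intro nn_integral_add)
    finally show ?thesis
      using ennreal_norm_simple_bochner_integral_le[OF s(1)] order_trans by blast
  qed
  moreover have "(\<lambda>i. (\<integral>\<^sup>+x. g x \<partial>M) + (\<integral>\<^sup>+x. H i x \<partial>M)) \<longlonglongrightarrow> (\<integral>\<^sup>+x. g x \<partial>M) + 0"
    by (intro tendsto_add s(4) tendsto_const)
  moreover have "(\<lambda>i. ennreal (norm (Bochner_Integration.simple_bochner_integral M (s i)))) \<longlonglongrightarrow> ennreal (norm v)"
    by (intro tendsto_ennrealI tendsto_norm s(5))
  ultimately show ?thesis
    by (intro LIMSEQ_le[of "\<lambda>i. ennreal (norm (Bochner_Integration.simple_bochner_integral M (s i)))"]) auto
qed

text \<open>The zero function has the integral \<open>v - w\<close>, whose norm is therefore bounded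
  by 0.\<close>

lemma has_L1_limit_integral_unique:
  assumes "has_L1_limit_integral M f v" "has_L1_limit_integral M f w"
  shows "v = w"
  using has_L1_limit_integral_norm_bound[OF has_L1_limit_integral_diff[OF assms], of "\<lambda>_. 0"] by simp

text \<open>The integrals of \<open>s i\<close> and \<open>s j\<close> differ by at most the
  integral of \<open>H i + H j\<close>, so they form a Cauchy sequence, and completeness provides
  the limit.\<close>

lemma has_L1_limit_integral_exists:
  fixes f :: "'a \<Rightarrow> 'b::banach"
  assumes s: "\<And>i. Bochner_Integration.simple_bochner_integrable M (s i)"
    and H [measurable]: "\<And>i. H i \<in> borel_measurable M"
    and le: "\<And>i x. x \<in> space M \<Longrightarrow> ennreal (norm (f x - s i x)) \<le> H i x"
    and lim: "(\<lambda>i. \<integral>\<^sup>+x. H i x \<partial>M) \<longlonglongrightarrow> 0"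
  shows "\<exists>v. has_L1_limit_integral M f v"
proof -
  let ?I = "\<lambda>i. Bochner_Integration.simple_bochner_integral M (s i)"
  have diff: "ennreal (norm (?I i - ?I j)) \<le> (\<integral>\<^sup>+x. H i x \<partial>M) + (\<integral>\<^sup>+x. H j x \<partial>M)" for i j
  proof -
    have sb: "Bochner_Integration.simple_bochner_integrable M (\<lambda>x. s i x - s j x)"
      by (rule simple_bochner_integrable_compose2[OF _ s s]) simp
    have "ennreal (norm (?I i - ?I j)) \<le> (\<integral>\<^sup>+x. norm (s i x - s j x) \<partial>M)"
      using ennreal_norm_simple_bochner_integral_le[OF sb] by (simp add: simple_bochner_integral_diff s)
    also have "\<dots> \<le> (\<integral>\<^sup>+x. H i x + H j x \<partial>M)"
    proof (rule nn_integral_mono)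
      fix x assume x: "x \<in> space M"
      have "ennreal (norm (s i x - s j x)) \<le> ennreal (norm (f x - s i x) + norm (f x - s j x))"
        using norm_triangle_ineq4[of "f x - s j x" "f x - s i x"] by (intro ennreal_leI) simp
      also have "\<dots> \<le> H i x + H j x" using le[OF x, of i] le[OF x, of j] by (simp add: add_mono)
      finally show "ennreal (norm (s i x - s j x)) \<le> H i x + H j x" .
    qed
    also have "\<dots> = (\<integral>\<^sup>+x. H i x \<partial>M) + (\<integral>\<^sup>+x. H j x \<partial>M)" by (intro nn_integral_add) auto
    finally show ?thesis .
  qed
  have "Cauchy ?I"
  proof (rule metric_CauchyI)
    fix e :: real assume e: "0 < e"
    have "eventually (\<lambda>i. (\<integral>\<^sup>+x. H i x \<partial>M) < ennreal (e/2)) sequentially"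
      using lim e by (intro order_tendstoD) auto
    then obtain N where N: "\<And>i. i \<ge> N \<Longrightarrow> (\<integral>\<^sup>+x. H i x \<partial>M) < ennreal (e/2)"
      unfolding eventually_sequentially by blast
    show "\<exists>N. \<forall>m\<ge>N. \<forall>n\<ge>N. dist (?I m) (?I n) < e"
    proof (intro exI allI impI)
      fix m n assume mn: "N \<le> m" "N \<le> n"
      have "ennreal (norm (?I m - ?I n)) < ennreal (e/2) + ennreal (e/2)"
        using diff N[OF mn(1)] N[OF mn(2)] by (meson add_strict_mono order_le_less_trans)
      also have "\<dots> = ennreal e" using e by (subst ennreal_plus[symmetric]) auto
      finally show "dist (?I m) (?I n) < e" by (simp add: dist_norm ennreal_less_iff)
    qed
  qed
  then obtain v where "?I \<longlonglongrightarrow> v" using Cauchy_convergent convergentD by blast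
  then show ?thesis using has_L1_limit_integralI[OF s H le lim] by blast
qed

section \<open>Integrals of a compactly supported weight times a continuous function\<close>

text \<open>Both factors are replaced by simple functions: \<open>\<psi>\<close> by a dominated
  sequence \<open>s i\<close>, and \<open>g\<close> by its values along step functions
  \<open>h i\<close>, uniformly close on the support of \<open>\<psi>\<close>. The products
  \<open>t i\<close> converge pointwise, which gives measurability, and with integrable errors,
  which gives the integral.\<close>

lemma has_vector_integral_scaleC_exists:
  fixes g :: "'g::topological_space \<Rightarrow> 'b::complex_banach" and \<psi> :: "'g \<Rightarrow> complex"
  assumes M: "sets M = sets borel" and \<psi>: "integrable M \<psi>"
    and K: "compact K" "{k. \<psi> k \<noteq> 0} \<subseteq> K" and g: "continuous_on UNIV g"
  shows "\<exists>v. has_vector_integral M (\<lambda>k. \<psi> k *\<^sub>C g k) v"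
proof -
  have spM: "space M = UNIV"
    using sets_eq_imp_space_eq[OF M] by simp
  \<comment> \<open>The extra point only guarantees a nonempty compact set.\<close>
  define K' where "K' = insert undefined K"
  have K': "compact K'" "K' \<noteq> {}" "\<And>k. k \<notin> K' \<Longrightarrow> \<psi> k = 0"
    using K by (auto simp: K'_def compact_insert)
  have "bounded (g ` K')"
    using K'(1) g by (intro compact_imp_bounded compact_continuous_image) (auto intro: continuous_on_subset)
  then obtain C where C: "\<And>k. k \<in> K' \<Longrightarrow> norm (g k) \<le> C" unfolding bounded_iff by blast
  have C0: "0 \<le> C" using C K'(2) norm_ge_zero order_trans by blast
  have "\<exists>h. simple_function M h \<and> range h \<subseteq> K' \<and>
      (\<forall>k\<in>K'. dist (g (h k)) (g k) < inverse (Suc i))" for i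
    by (rule finite_range_approximation_on_compact[OF K'(1,2) g M, of "inverse (Suc i)"]) auto
  then obtain h where h: "\<And>i. simple_function M (h i)" "\<And>i. range (h i) \<subseteq> K'"
    "\<And>i k. k \<in> K' \<Longrightarrow> dist (g (h i k)) (g k) < inverse (Suc i)" by metis
  have [measurable]: "\<psi> \<in> borel_measurable M" using \<psi> by simp
  obtain s where s: "\<And>i. simple_function M (s i)" "\<And>x. (\<lambda>i. s i x) \<longlonglongrightarrow> \<psi> x"
    "\<And>i x. norm (s i x) \<le> 2 * norm (\<psi> x)"
    using borel_measurable_implies_sequence_metric[of \<psi> M 0] by (auto simp: spM)
  have [measurable]: "s i \<in> borel_measurable M" for i
    by (rule borel_measurable_simple_function[OF s(1)])
  have fin: "(\<integral>\<^sup>+x. norm (\<psi> x) \<partial>M) < \<infinity>" using \<psi> by (simp add: integrable_iff_bounded)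
  have fin2: "(\<integral>\<^sup>+x. ennreal (2 * norm (\<psi> x)) \<partial>M) < \<infinity>"
    using fin by (simp add: nn_integral_cmult ennreal_mult ennreal_mult_less_top)
  have lim_s: "(\<lambda>i. \<integral>\<^sup>+x. norm (\<psi> x - s i x) \<partial>M) \<longlonglongrightarrow> 0"
    by (rule nn_integral_dominated_convergence_norm[where w="\<lambda>x. 2 * norm (\<psi> x)"])
       (use s fin2 in auto)
  define t where "t i k = s i k *\<^sub>C g (h i k)" for i k
  \<comment> \<open>The first term pays for replacing \<open>g k\<close> by
    \<open>g (h i k)\<close>, the second for replacing \<open>\<psi>\<close> by \<open>s i\<close>.
    Outside \<open>K'\<close>, where \<open>h i\<close> need not approximate, the weight
    \<open>\<psi>\<close> vanishes.\<close>
  define H where "H i k = norm (\<psi> k) * inverse (Suc i) + C * norm (\<psi> k - s i k)" for i k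
  have sf_t: "simple_function M (t i)" for i
    unfolding t_def by (rule simple_function_compose2[OF s(1) h(1)])
  have "Bochner_Integration.simple_bochner_integrable M (s i)" for i
  proof (rule simple_bochner_integrableI_bounded[OF s(1)])
    have "(\<integral>\<^sup>+x. norm (s i x) \<partial>M) \<le> (\<integral>\<^sup>+x. ennreal (2 * norm (\<psi> x)) \<partial>M)"
      by (intro nn_integral_mono ennreal_leI s(3))
    then show "(\<integral>\<^sup>+x. norm (s i x) \<partial>M) < \<infinity>" using fin2 by (rule order_le_less_trans)
  qed
  then have "emeasure M {y\<in>space M. s i y \<noteq> 0} \<noteq> \<infinity>" for i
    by (simp add: simple_bochner_integrable.simps)
  \<comment> \<open>\<open>t i\<close> vanishes wherever \<open>s i\<close> does, so its support has
    finite measure as well.\<close>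
  moreover have "emeasure M {y\<in>space M. t i y \<noteq> 0} \<le> emeasure M {y\<in>space M. s i y \<noteq> 0}" for i
    by (intro emeasure_mono) (auto simp: t_def)
  ultimately have sb_t: "Bochner_Integration.simple_bochner_integrable M (t i)" for i
    using sf_t by (intro simple_bochner_integrable.intros) (auto dest: neq_top_trans)
  have le: "norm (\<psi> k *\<^sub>C g k - t i k) \<le> H i k" for i k
  proof -
    have "\<psi> k *\<^sub>C g k - t i k = \<psi> k *\<^sub>C (g k - g (h i k)) + (\<psi> k - s i k) *\<^sub>C g (h i k)"
      by (simp add: t_def complex_vector.scale_right_diff_distrib complex_vector.scale_left_diff_distrib)
    then have "norm (\<psi> k *\<^sub>C g k - t i k) \<le>
        norm (\<psi> k *\<^sub>C (g k - g (h i k))) + norm ((\<psi> k - s i k) *\<^sub>C g (h i k))"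
      using norm_triangle_ineq by metis
    also have "norm (\<psi> k *\<^sub>C (g k - g (h i k))) \<le> norm (\<psi> k) * inverse (Suc i)"
    proof (cases "k \<in> K'")
      case True
      have "norm (g k - g (h i k)) \<le> inverse (Suc i)"
        using h(3)[OF True, of i] by (simp add: dist_norm norm_minus_commute)
      then show ?thesis unfolding norm_scaleC by (rule mult_left_mono) simp
    qed (use K'(3) in \<open>simp add: norm_scaleC\<close>)
    also have "norm ((\<psi> k - s i k) *\<^sub>C g (h i k)) \<le> C * norm (\<psi> k - s i k)"
    proof -
      have "norm (g (h i k)) \<le> C" using C h(2) by blast
      then show ?thesis unfolding norm_scaleC by (subst mult.commute) (rule mult_right_mono, simp_all)
    qed
    finally show ?thesis by (simp add: H_def)
  qed
  have lim_inv: "(\<lambda>i. r * inverse (real (Suc i))) \<longlonglongrightarrow> 0" for r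
    using tendsto_mult[OF tendsto_const LIMSEQ_inverse_real_of_nat, of r] by simp
  have "(\<lambda>i. t i k) \<longlonglongrightarrow> \<psi> k *\<^sub>C g k" for k
  proof -
    have "(\<lambda>i. norm (\<psi> k) * inverse (real (Suc i)) + C * norm (\<psi> k - s i k)) \<longlonglongrightarrow> 0 + C * norm (\<psi> k - \<psi> k)"
      by (intro tendsto_intros lim_inv s(2))
    then have "(\<lambda>i. \<psi> k *\<^sub>C g k - t i k) \<longlonglongrightarrow> 0"
      by (intro Lim_null_comparison[OF always_eventually[OF allI[OF le]]]) (simp add: H_def)
    then have "(\<lambda>i. \<psi> k *\<^sub>C g k - (\<psi> k *\<^sub>C g k - t i k)) \<longlonglongrightarrow> \<psi> k *\<^sub>C g k - 0"
      by (intro tendsto_intros)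
    then show ?thesis by simp
  qed
  then have meas: "(\<lambda>k. \<psi> k *\<^sub>C g k) \<in> borel_measurable M"
    by (rule borel_measurable_LIMSEQ_metric[OF borel_measurable_simple_function[OF sf_t]])
  have limH: "(\<lambda>i. \<integral>\<^sup>+x. ennreal (H i x) \<partial>M) \<longlonglongrightarrow> 0"
  proof -
    obtain r where r: "(\<integral>\<^sup>+x. norm (\<psi> x) \<partial>M) = ennreal r" "0 \<le> r"
      using fin by (cases "\<integral>\<^sup>+x. norm (\<psi> x) \<partial>M") auto
    have "(\<integral>\<^sup>+x. ennreal (H i x) \<partial>M) =
        ennreal (r * inverse (Suc i)) + ennreal C * (\<integral>\<^sup>+x. norm (\<psi> x - s i x) \<partial>M)" for i
    proof -
      have "(\<integral>\<^sup>+x. ennreal (H i x) \<partial>M) =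
          (\<integral>\<^sup>+x. ennreal (norm (\<psi> x)) * ennreal (inverse (Suc i)) + ennreal C * ennreal (norm (\<psi> x - s i x)) \<partial>M)"
        using C0 by (intro nn_integral_cong) (simp add: H_def ennreal_mult)
      also have "\<dots> = (\<integral>\<^sup>+x. norm (\<psi> x) \<partial>M) * ennreal (inverse (Suc i)) +
          ennreal C * (\<integral>\<^sup>+x. norm (\<psi> x - s i x) \<partial>M)"
        by (subst nn_integral_add) (auto simp: nn_integral_cmult nn_integral_multc)
      finally show ?thesis using r by (simp add: ennreal_mult)
    qed
    moreover have "(\<lambda>i. ennreal (r * inverse (Suc i)) + ennreal C * (\<integral>\<^sup>+x. norm (\<psi> x - s i x) \<partial>M))
        \<longlonglongrightarrow> ennreal 0 + ennreal C * 0"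
      by (intro tendsto_add tendsto_ennrealI lim_inv ennreal_tendsto_cmult lim_s) simp
    ultimately show ?thesis by simp
  qed
  have "\<exists>v. has_L1_limit_integral M (\<lambda>k. \<psi> k *\<^sub>C g k) v"
  proof (rule has_L1_limit_integral_exists[where s=t and H="\<lambda>i k. ennreal (H i k)"])
    show "(\<lambda>k. ennreal (H i k)) \<in> borel_measurable M" for i
      unfolding H_def by measurable
  qed (use sb_t le limH in \<open>auto intro: ennreal_leI\<close>)
  then show ?thesis using has_vector_integral_of_has_L1_limit_integral[OF meas] by blast
qed

lemma has_L1_limit_integral_norm_le:
  fixes \<psi> :: "'a \<Rightarrow> 'c::{banach, second_countable_topology}"
  assumes f: "has_L1_limit_integral M f v" and \<psi>: "integrable M \<psi>" and B: "0 \<le> B"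
    and le: "\<And>x. norm (f x) \<le> norm (\<psi> x) * B"
  shows "norm v \<le> (\<integral>x. norm (\<psi> x) \<partial>M) * B"
proof -
  have i: "integrable M (\<lambda>x. norm (\<psi> x) * B)"
    by (intro integrable_mult_left impI integrable_norm[OF \<psi>])
  have "ennreal (norm v) \<le> (\<integral>\<^sup>+x. ennreal (norm (\<psi> x) * B) \<partial>M)"
    using borel_measurable_integrable[OF i]
    by (intro has_L1_limit_integral_norm_bound[OF f] ennreal_leI le measurable_compose[OF _ measurable_ennreal])
  also have "\<dots> = ennreal (\<integral>x. norm (\<psi> x) * B \<partial>M)"
    using B by (intro nn_integral_eq_integral i) auto
  finally have "norm v \<le> (\<integral>x. norm (\<psi> x) * B \<partial>M)"
    using B by (subst (asm) ennreal_le_iff) (auto intro!: integral_nonneg_AE)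
  then show ?thesis by simp
qed

section \<open>The operators \<open>\<phi>(Q)\<close> and the multiplier algebra\<close>

text \<open>Strong continuity bounds every orbit \<open>V k u\<close> on the compact set, and the
  uniform boundedness principle turns these bounds into one for the operator norms; norm continuity
  of \<open>V\<close> is not assumed.\<close>

lemma banach_group_module_bounded_on_compact:
  fixes V :: "'x::topological_ab_group_add dual_group \<Rightarrow> 'h::complex_banach \<Rightarrow>\<^sub>L 'h"
  assumes V: "banach_group_module V" and K: "compact K"
  shows "\<exists>C\<ge>0. \<forall>k\<in>K. norm (V k) \<le> C"
proof -
  have "\<exists>B. \<forall>T\<in>V ` K. norm (blinfun_apply T u) \<le> B" for u
  proof -
    have "continuous_on K (\<lambda>k. blinfun_apply (V k) u)"
      using V unfolding banach_group_module_def by (meson continuous_on_subset subset_UNIV)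
    then have "bounded ((\<lambda>k. blinfun_apply (V k) u) ` K)"
      using K by (intro compact_imp_bounded compact_continuous_image)
    then show ?thesis unfolding bounded_iff by auto
  qed
  from uniformly_bounded_of_pointwise_bounded[OF this] show ?thesis by simp
qed

text \<open>The integrals exist vector by vector. Their uniqueness makes the value complex-linear in
  \<open>u\<close>, and a bound \<open>C\<close> of the norms of \<open>V k\<close> on the support
  of \<open>\<psi>\<close> bounds the resulting map by \<open>C\<close> times the L1 norm of
  \<open>\<psi>\<close>.\<close>

lemma function_of_Q_exists:
  fixes V :: "'x::topological_ab_group_add dual_group \<Rightarrow> 'h::complex_banach \<Rightarrow>\<^sub>L 'h"
  assumes M: "sets \<nu> = sets borel" and V: "banach_group_module V" and \<psi>: "\<psi> \<in> L1_compact_support \<nu>"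
  shows "\<exists>A\<in>bounded_ops.
    \<forall>u. has_vector_integral \<nu> (\<lambda>k. \<psi> k *\<^sub>C blinfun_apply (V k) u) (blinfun_apply A u)"
proof -
  define K where "K = closure {k. \<psi> k \<noteq> 0}"
  have int: "integrable \<nu> \<psi>" and K: "compact K" "{k. \<psi> k \<noteq> 0} \<subseteq> K"
    using \<psi> closure_subset[of "{k. \<psi> k \<noteq> 0}"] by (auto simp: L1_compact_support_def K_def)
  obtain C where C: "0 \<le> C" "\<And>k. k \<in> K \<Longrightarrow> norm (V k) \<le> C"
    using banach_group_module_bounded_on_compact[OF V K(1)] by blast
  have Vcont: "continuous_on UNIV (\<lambda>k. blinfun_apply (V k) u)" for u
    using V by (simp add: banach_group_module_def)
  have VC: "blinfun_apply (V k) (c *\<^sub>C u) = c *\<^sub>C blinfun_apply (V k) u" for k c u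
    using V by (auto simp: banach_group_module_def bounded_ops_def)
  have "\<forall>u. \<exists>v. has_vector_integral \<nu> (\<lambda>k. \<psi> k *\<^sub>C blinfun_apply (V k) u) v"
    using has_vector_integral_scaleC_exists[OF M int K Vcont] by blast
  then obtain a where a: "\<And>u. has_vector_integral \<nu> (\<lambda>k. \<psi> k *\<^sub>C blinfun_apply (V k) u) (a u)" by metis
  note a1 = a[THEN has_L1_limit_integral_of_has_vector_integral]
  have add: "a (u + w) = a u + a w" for u w
    by (rule has_L1_limit_integral_unique[OF a1])
       (use has_L1_limit_integral_add[OF a1[of u] a1[of w]] in \<open>simp add: blinfun.bilinear_simps scaleC_add_right\<close>)
  have scale: "a (c *\<^sub>C u) = c *\<^sub>C a u" for c u
    by (rule has_L1_limit_integral_unique[OF a1])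
       (use has_L1_limit_integral_bounded_linear[OF bounded_linear_scaleC a1[of u], of c]
        in \<open>simp add: VC scaleC_scaleC mult.commute\<close>)
  have bl: "bounded_linear a"
  proof (rule bounded_linear_intro[where K="(\<integral>k. norm (\<psi> k) \<partial>\<nu>) * C"])
    show "a (r *\<^sub>R u) = r *\<^sub>R a u" for r u
      using scale[of "complex_of_real r" u] by (simp add: scaleC_of_real)
    fix u
    have "norm (a u) \<le> (\<integral>k. norm (\<psi> k) \<partial>\<nu>) * (C * norm u)"
    proof (rule has_L1_limit_integral_norm_le[OF a1 int])
      fix k
      show "norm (\<psi> k *\<^sub>C blinfun_apply (V k) u) \<le> norm (\<psi> k) * (C * norm u)"
      proof (cases "k \<in> K")
        case True
        have "norm (blinfun_apply (V k) u) \<le> C * norm u"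
          using norm_blinfun[of "V k" u] C(2)[OF True] by (meson mult_right_mono norm_ge_zero order_trans)
        then show ?thesis unfolding norm_scaleC by (rule mult_left_mono) simp
      next
        case False
        then have "\<psi> k = 0" using K(2) by blast
        then show ?thesis by (simp add: norm_scaleC)
      qed
    qed (use C in auto)
    then show "norm (a u) \<le> norm u * ((\<integral>k. norm (\<psi> k) \<partial>\<nu>) * C)" by (simp add: ac_simps)
  qed (rule add)
  show ?thesis
  proof (intro bexI[of _ "Blinfun a"] allI)
    show "Blinfun a \<in> bounded_ops"
      by (simp add: bounded_ops_def bounded_linear_Blinfun_apply[OF bl] scale)
    show "has_vector_integral \<nu> (\<lambda>k. \<psi> k *\<^sub>C blinfun_apply (V k) u) (blinfun_apply (Blinfun a) u)" for u
      using a by (simp add: bounded_linear_Blinfun_apply[OF bl])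
  qed
qed

text \<open>The symbol is the inverse Fourier integral of \<open>\<psi>\<close>; as
  \<open>\<psi>\<close> is integrable, the second alternative of
  \<open>has_fourier_transform\<close> holds by construction. Thus any integrable weight with
  compact support, in particular one cut off to a Borel set, yields an element of the multiplier
  algebra.\<close>

lemma function_of_Q_in_multiplier_algebra:
  assumes \<psi>: "\<psi> \<in> L1_compact_support \<nu>" and A: "A \<in> bounded_ops"
    and int: "\<And>u. has_vector_integral \<nu> (\<lambda>k. \<psi> k *\<^sub>C blinfun_apply (V k) u) (blinfun_apply A u)"
  shows "A \<in> multiplier_algebra \<mu> \<nu> V"
proof -
  let ?\<phi> = "inverse_fourier_integral \<nu> \<psi>"
  have ft: "has_fourier_transform \<mu> \<nu> ?\<phi> \<psi>"
    using \<psi> by (simp add: has_fourier_transform_def L1_compact_support_def)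
  then have "?\<phi> \<in> C_a \<mu> \<nu>" using \<psi> unfolding C_a_def by blast
  moreover have "is_function_of_Q \<mu> \<nu> V ?\<phi> A"
    unfolding is_function_of_Q_def using \<psi> ft int by blast
  ultimately have "A \<in> {A \<in> bounded_ops. \<exists>\<phi>\<in>C_a \<mu> \<nu>. is_function_of_Q \<mu> \<nu> V \<phi> A}"
    using A by blast
  then show ?thesis unfolding multiplier_algebra_def by (rule subsetD[OF closure_subset])
qed

section \<open>Norm approximation of operator integrals by finite sums\<close>

text \<open>The second argument of \<open>P\<close> is frozen at finitely many points: each level set of the step function
  that replaces it contributes one element of \<open>Y\<close>.\<close>

lemma integral_operator_in_closure_cspan:
  fixes P :: "'g::topological_space \<Rightarrow> 'g \<Rightarrow> ('h::complex_banach \<Rightarrow>\<^sub>L 'k::complex_banach)"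
    and S :: "'g \<Rightarrow> 'b::metric_space"
  assumes M: "sets \<nu> = sets borel" and \<psi>: "\<psi> \<in> L1_compact_support \<nu>"
    and S: "continuous_on UNIV S" and C: "0 \<le> C"
    and P: "\<And>k l. \<psi> k \<noteq> 0 \<Longrightarrow> norm (P k k - P k l) \<le> C * dist (S l) (S k)"
    and Y: "\<And>\<psi>' l. \<psi>' \<in> L1_compact_support \<nu> \<Longrightarrow>
      \<exists>E\<in>Y. \<forall>u. has_L1_limit_integral \<nu> (\<lambda>k. \<psi>' k *\<^sub>C blinfun_apply (P k l) u) (blinfun_apply E u)"
    and D: "\<And>u. has_L1_limit_integral \<nu> (\<lambda>k. \<psi> k *\<^sub>C blinfun_apply (P k k) u) (blinfun_apply D u)"
  shows "D \<in> closure (cspan Y)"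
  unfolding closure_approachable
proof (intro allI impI)
  fix e :: real assume e: "0 < e"
  define I where "I = (\<integral>k. norm (\<psi> k) \<partial>\<nu>)"
  \<comment> \<open>The error will be at most \<open>I * C * \<delta>\<close>. The summand 1 keeps
    the denominator positive when \<open>I * C\<close> is 0 and makes this bound strictly less than
    \<open>e\<close>.\<close>
  define \<delta> where "\<delta> = e / (I * C + 1)"
  have I: "0 \<le> I" unfolding I_def by (intro integral_nonneg_AE) auto
  then have IC: "0 < I * C + 1" using C by (simp add: add_nonneg_pos)
  then have \<delta>: "0 < \<delta>" using e by (simp add: \<delta>_def)
  define K where "K = insert undefined (closure {k. \<psi> k \<noteq> 0})"
  have int: "integrable \<nu> \<psi>" and K: "compact K" "K \<noteq> {}" "{k. \<psi> k \<noteq> 0} \<subseteq> K"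
    using \<psi> closure_subset[of "{k. \<psi> k \<noteq> 0}"]
    by (auto simp: L1_compact_support_def K_def compact_insert)
  obtain h where h: "simple_function \<nu> h" "finite (range h)" "\<And>k. k \<in> K \<Longrightarrow> dist (S (h k)) (S k) < \<delta>"
    using finite_range_approximation_on_compact[OF K(1,2) S M \<delta>] by metis
  \<comment> \<open>\<open>\<psi>' y\<close> is \<open>\<psi>\<close> restricted to the Borel level
    set where \<open>h\<close> equals \<open>y\<close>; its support remains inside that of
    \<open>\<psi>\<close>.\<close>
  define \<psi>' where "\<psi>' y k = (if h k = y then \<psi> k else 0)" for y k
  have L1: "\<psi>' y \<in> L1_compact_support \<nu>" for y
  proof -
    have "h -` {y} \<inter> space \<nu> \<in> sets \<nu>" using h(1) by (rule simple_functionD)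
    then have "integrable \<nu> (\<lambda>k. indicator (h -` {y} \<inter> space \<nu>) k *\<^sub>R \<psi> k)"
      using int by (rule integrable_mult_indicator)
    also have "(\<lambda>k. indicator (h -` {y} \<inter> space \<nu>) k *\<^sub>R \<psi> k) = \<psi>' y"
      using sets_eq_imp_space_eq[OF M] by (auto simp: \<psi>'_def fun_eq_iff)
    finally have "integrable \<nu> (\<psi>' y)" .
    moreover have "closure {k. \<psi>' y k \<noteq> 0} \<subseteq> closure {k. \<psi> k \<noteq> 0}"
      by (intro closure_mono) (auto simp: \<psi>'_def)
    then have "compact (closure {k. \<psi>' y k \<noteq> 0})"
      using \<psi> compact_Int_closed[of "closure {k. \<psi> k \<noteq> 0}" "closure {k. \<psi>' y k \<noteq> 0}"]
      by (simp add: L1_compact_support_def Int_absorb1)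
    ultimately show ?thesis by (simp add: L1_compact_support_def)
  qed
  have "\<forall>y. \<exists>E. E \<in> Y \<and>
      (\<forall>u. has_L1_limit_integral \<nu> (\<lambda>k. \<psi>' y k *\<^sub>C blinfun_apply (P k y) u) (blinfun_apply E u))"
    using Y[OF L1] by blast
  from choice[OF this] obtain E where E: "\<And>y. E y \<in> Y"
    "\<And>y u. has_L1_limit_integral \<nu> (\<lambda>k. \<psi>' y k *\<^sub>C blinfun_apply (P k y) u) (blinfun_apply (E y) u)"
    by blast
  let ?E = "\<Sum>y\<in>range h. E y"
  have "?E \<in> cspan Y"
    by (intro complex_vector.span_sum complex_vector.span_base E)
  moreover have "norm (D - ?E) \<le> I * (C * \<delta>)"
  proof (rule norm_blinfun_bound)
    fix u
    have "has_L1_limit_integral \<nu>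
        (\<lambda>k. \<psi> k *\<^sub>C blinfun_apply (P k k) u - (\<Sum>y\<in>range h. \<psi>' y k *\<^sub>C blinfun_apply (P k y) u))
        (blinfun_apply D u - (\<Sum>y\<in>range h. blinfun_apply (E y) u))"
      by (intro has_L1_limit_integral_diff has_L1_limit_integral_sum D E)
    \<comment> \<open>For a given \<open>k\<close> only the term \<open>y = h k\<close> survives, so
      the finite sum of operators integrates \<open>P\<close> frozen at \<open>h k\<close>.\<close>
    moreover have "(\<Sum>y\<in>range h. \<psi>' y k *\<^sub>C blinfun_apply (P k y) u) =
        \<psi> k *\<^sub>C blinfun_apply (P k (h k)) u" for k
    proof -
      have "(\<Sum>y\<in>range h. \<psi>' y k *\<^sub>C blinfun_apply (P k y) u) =
          (\<Sum>y\<in>range h. if h k = y then \<psi> k *\<^sub>C blinfun_apply (P k y) u else 0)"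
        by (intro sum.cong) (auto simp: \<psi>'_def)
      then show ?thesis using h(2) by simp
    qed
    ultimately have "has_L1_limit_integral \<nu>
        (\<lambda>k. \<psi> k *\<^sub>C blinfun_apply (P k k - P k (h k)) u) (blinfun_apply (D - ?E) u)"
      by (simp add: blinfun.bilinear_simps complex_vector.scale_right_diff_distrib)
    then have "norm (blinfun_apply (D - ?E) u) \<le> I * (C * \<delta> * norm u)"
      unfolding I_def
    proof (rule has_L1_limit_integral_norm_le[OF _ int])
      fix k
      show "norm (\<psi> k *\<^sub>C blinfun_apply (P k k - P k (h k)) u) \<le> norm (\<psi> k) * (C * \<delta> * norm u)"
      proof (cases "\<psi> k = 0")
        case False
        then have "dist (S (h k)) (S k) \<le> \<delta>" using h(3)[of k] K(3) by auto
        then have "norm (P k k - P k (h k)) \<le> C * \<delta>"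
          using P[OF False, of "h k"] C by (meson mult_left_mono order_trans)
        then have "norm (blinfun_apply (P k k - P k (h k)) u) \<le> C * \<delta> * norm u"
          using norm_blinfun[of "P k k - P k (h k)" u] by (meson mult_right_mono norm_ge_zero order_trans)
        then show ?thesis unfolding norm_scaleC by (rule mult_left_mono) simp
      qed (simp add: norm_scaleC)
    qed (use C \<delta> in auto)
    then show "norm (blinfun_apply (D - ?E) u) \<le> I * (C * \<delta>) * norm u" by (simp add: ac_simps)
  qed (use I C \<delta> in auto)
  moreover have "I * (C * \<delta>) < e"
    using IC e by (simp add: \<delta>_def field_simps)
  ultimately show "\<exists>E\<in>cspan Y. dist E D < e"
    by (intro bexI[of _ ?E]) (auto simp: dist_norm norm_minus_commute)
qed

section \<open>Decay preservation of the operators in \<open>Cu_Q\<close>\<close>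

lemma bounded_ops_compose: "A \<in> bounded_ops \<Longrightarrow> B \<in> bounded_ops \<Longrightarrow> A o\<^sub>L B \<in> bounded_ops"
  by (simp add: bounded_ops_def)

text \<open>Reduces the two claims about the multiplier algebra, which is a closure, to the
  operators \<open>\<phi>(Q)\<close> dense in it.\<close>

lemma mem_closed_of_mem_closure:
  assumes "M \<in> closure Z" "continuous_on UNIV f" "closed B" "\<And>A. A \<in> Z \<Longrightarrow> f A \<in> B"
  shows "f M \<in> B"
proof -
  have "f ` closure Z \<subseteq> closure (f ` Z)"
    using assms(2) by (intro continuous_image_closure_subset) auto
  also have "\<dots> \<subseteq> B" using assms by (intro closure_minimal) auto
  finally show ?thesis using assms(1) by blast
qed

theorem proposition4p10:
  fixes \<mu> :: "'x::{topological_ab_group_add, t2_space} measure"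
    and \<nu> :: "'x dual_group measure"
    and V :: "'x dual_group \<Rightarrow> 'h::complex_banach \<Rightarrow>\<^sub>L 'h"
    and W :: "'x dual_group \<Rightarrow> 'k::complex_banach \<Rightarrow>\<^sub>L 'k"
    and T :: "'h \<Rightarrow>\<^sub>L 'k"
  assumes "locally_compact_space (euclidean :: 'x topology)"
    and "\<not> compact (UNIV :: 'x set)"
    and "haar_measure \<mu>" and "haar_measure \<nu>" and "fourier_normalized \<mu> \<nu>"
    and "banach_group_module V" and "banach_group_module W"
    and "T \<in> Cu_Q V W"
  shows "decay_preserving \<mu> \<nu> V W T"
proof -
  note V = \<open>banach_group_module V\<close> and W = \<open>banach_group_module W\<close>
  have M: "sets \<nu> = sets borel" using \<open>haar_measure \<nu>\<close> by (simp add: haar_measure_def)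
  define S where "S k = W (- k) o\<^sub>L T o\<^sub>L V k" for k
  have T: "T \<in> bounded_ops" and S: "continuous_on UNIV S"
    using \<open>T \<in> Cu_Q V W\<close> unfolding Cu_Q_def S_def[abs_def] by simp_all
  have Vops: "V k \<in> bounded_ops" and Wops: "W k \<in> bounded_ops" for k
    using V W by (auto simp: banach_group_module_def)
  have Sops: "S k \<in> bounded_ops" for k
    unfolding S_def by (intro bounded_ops_compose T Vops Wops)
  have V0: "V (- k) o\<^sub>L V k = id_blinfun" for k
    using V unfolding banach_group_module_def by (metis add.left_inverse)
  have W0: "W k o\<^sub>L W (- k) = id_blinfun" for k
    using W unfolding banach_group_module_def by (metis add.right_inverse)
  have WS: "W k o\<^sub>L S k = T o\<^sub>L V k" for k
  proof (rule blinfun_eqI)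
    show "blinfun_apply (W k o\<^sub>L S k) u = blinfun_apply (T o\<^sub>L V k) u" for u
      using W0[of k, THEN arg_cong, of "\<lambda>A. blinfun_apply A (blinfun_apply T (blinfun_apply (V k) u))"]
      by (simp add: S_def)
  qed
  \<comment> \<open>Here \<open>S (- k)\<close> is \<open>W k o\<^sub>L T o\<^sub>L V (- k)\<close>,
    since the sign in \<open>S\<close> cancels, and \<open>V k\<close> removes the last
    factor.\<close>
  have SV: "S (- k) o\<^sub>L V k = W k o\<^sub>L T" for k
  proof (rule blinfun_eqI)
    show "blinfun_apply (S (- k) o\<^sub>L V k) u = blinfun_apply (W k o\<^sub>L T) u" for u
      using V0[of k, THEN arg_cong, of "\<lambda>A. blinfun_apply A u"] by (simp add: S_def)
  qed
  have Sm: "continuous_on UNIV (\<lambda>k. S (- k))"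
    by (rule continuous_on_compose2[OF S]) (auto intro: continuous_intros)
  have left: "T o\<^sub>L A \<in> B0_left \<mu> \<nu> W" if A: "A \<in> bounded_ops" "is_function_of_Q \<mu> \<nu> V \<phi> A" for A \<phi>
  proof -
    obtain \<psi> where \<psi>: "\<psi> \<in> L1_compact_support \<nu>"
      and int: "\<And>u. has_vector_integral \<nu> (\<lambda>k. \<psi> k *\<^sub>C blinfun_apply (V k) u) (blinfun_apply A u)"
      using A(2) unfolding is_function_of_Q_def by blast
    then have "compact (closure {k. \<psi> k \<noteq> 0})" by (simp add: L1_compact_support_def)
    then obtain C where C: "0 \<le> C" "\<And>k. k \<in> closure {k. \<psi> k \<noteq> 0} \<Longrightarrow> norm (W k) \<le> C"
      using banach_group_module_bounded_on_compact[OF W] by blast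
    \<comment> \<open>Only the factor \<open>S\<close> is frozen, as it is the norm continuous one.
      The factor \<open>W k\<close> stays under the integral, where it produces an element of the
      multiplier algebra of \<open>W\<close> to the left of the fixed operator
      \<open>S l\<close>.\<close>
    show ?thesis unfolding B0_left_def
    proof (rule integral_operator_in_closure_cspan[OF M \<psi> S C(1), where P="\<lambda>k l. W k o\<^sub>L S l"])
      fix k l assume "\<psi> k \<noteq> 0"
      then have "norm (W k) \<le> C" using C(2)[OF subsetD[OF closure_subset]] by simp
      then have "norm (W k o\<^sub>L (S k - S l)) \<le> C * norm (S k - S l)"
        using norm_blinfun_compose by (meson mult_right_mono norm_ge_zero order_trans)
      then show "norm ((W k o\<^sub>L S k) - (W k o\<^sub>L S l)) \<le> C * dist (S l) (S k)"
        by (simp add: dist_norm norm_minus_commute bounded_bilinear.diff_right[OF bounded_bilinear_blinfun_compose])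
    next
      fix \<psi>' l assume \<psi>': "\<psi>' \<in> L1_compact_support \<nu>"
      obtain N where N: "N \<in> bounded_ops"
        "\<And>u. has_vector_integral \<nu> (\<lambda>k. \<psi>' k *\<^sub>C blinfun_apply (W k) u) (blinfun_apply N u)"
        using function_of_Q_exists[OF M W \<psi>'] by blast
      have "has_L1_limit_integral \<nu> (\<lambda>k. \<psi>' k *\<^sub>C blinfun_apply (W k o\<^sub>L S l) u)
          (blinfun_apply (N o\<^sub>L S l) u)" for u
        using has_L1_limit_integral_of_has_vector_integral[OF N(2)[of "blinfun_apply (S l) u"]] by simp
      moreover have "N o\<^sub>L S l \<in> {N o\<^sub>L R | N R. N \<in> multiplier_algebra \<mu> \<nu> W \<and> R \<in> bounded_ops}"
        using function_of_Q_in_multiplier_algebra[OF \<psi>' N] Sops[of l] by blast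
      ultimately show "\<exists>E\<in>{N o\<^sub>L R | N R. N \<in> multiplier_algebra \<mu> \<nu> W \<and> R \<in> bounded_ops}. \<forall>u.
          has_L1_limit_integral \<nu> (\<lambda>k. \<psi>' k *\<^sub>C blinfun_apply (W k o\<^sub>L S l) u) (blinfun_apply E u)"
        by (intro bexI[of _ "N o\<^sub>L S l"] allI)
    next
      fix u
      \<comment> \<open>\<open>T\<close> is moved under the integral; its complex linearity extracts
        the scalar, and \<open>WS\<close> rewrites \<open>T o\<^sub>L V k\<close> as
        \<open>W k o\<^sub>L S k\<close>.\<close>
      have "has_L1_limit_integral \<nu> (\<lambda>k. blinfun_apply T (\<psi> k *\<^sub>C blinfun_apply (V k) u))
          (blinfun_apply T (blinfun_apply A u))"
        by (rule has_L1_limit_integral_bounded_linear[OF blinfun.bounded_linear_right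
              has_L1_limit_integral_of_has_vector_integral[OF int]])
      then show "has_L1_limit_integral \<nu> (\<lambda>k. \<psi> k *\<^sub>C blinfun_apply (W k o\<^sub>L S k) u)
          (blinfun_apply (T o\<^sub>L A) u)"
        using T by (simp add: WS bounded_ops_def)
    qed
  qed
  have right: "A o\<^sub>L T \<in> B0_right \<mu> \<nu> V" if A: "A \<in> bounded_ops" "is_function_of_Q \<mu> \<nu> W \<phi> A" for A \<phi>
  proof -
    obtain \<psi> where \<psi>: "\<psi> \<in> L1_compact_support \<nu>"
      and int: "\<And>u. has_vector_integral \<nu> (\<lambda>k. \<psi> k *\<^sub>C blinfun_apply (W k) u) (blinfun_apply A u)"
      using A(2) unfolding is_function_of_Q_def by blast
    then have "compact (closure {k. \<psi> k \<noteq> 0})" by (simp add: L1_compact_support_def)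
    then obtain C where C: "0 \<le> C" "\<And>k. k \<in> closure {k. \<psi> k \<noteq> 0} \<Longrightarrow> norm (V k) \<le> C"
      using banach_group_module_bounded_on_compact[OF V] by blast
    show ?thesis unfolding B0_right_def
    proof (rule integral_operator_in_closure_cspan[OF M \<psi> Sm C(1), where P="\<lambda>k l. S (- l) o\<^sub>L V k"])
      fix k l assume "\<psi> k \<noteq> 0"
      then have "norm (V k) \<le> C" using C(2)[OF subsetD[OF closure_subset]] by simp
      then have "norm ((S (- k) - S (- l)) o\<^sub>L V k) \<le> norm (S (- k) - S (- l)) * C"
        using norm_blinfun_compose by (meson mult_left_mono norm_ge_zero order_trans)
      then show "norm ((S (- k) o\<^sub>L V k) - (S (- l) o\<^sub>L V k)) \<le> C * dist (S (- l)) (S (- k))"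
        by (simp add: dist_norm norm_minus_commute bounded_bilinear.diff_left[OF bounded_bilinear_blinfun_compose] mult.commute)
    next
      fix \<psi>' l assume \<psi>': "\<psi>' \<in> L1_compact_support \<nu>"
      obtain N where N: "N \<in> bounded_ops"
        "\<And>u. has_vector_integral \<nu> (\<lambda>k. \<psi>' k *\<^sub>C blinfun_apply (V k) u) (blinfun_apply N u)"
        using function_of_Q_exists[OF M V \<psi>'] by blast
      have "has_L1_limit_integral \<nu> (\<lambda>k. \<psi>' k *\<^sub>C blinfun_apply (S (- l) o\<^sub>L V k) u)
          (blinfun_apply (S (- l) o\<^sub>L N) u)" for u
        using has_L1_limit_integral_bounded_linear[OF blinfun.bounded_linear_right[of "S (- l)"]
            has_L1_limit_integral_of_has_vector_integral[OF N(2)[of u]]] Sops[of "- l"]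
        by (simp add: bounded_ops_def)
      moreover have "S (- l) o\<^sub>L N \<in> {R o\<^sub>L M | R M. R \<in> bounded_ops \<and> M \<in> multiplier_algebra \<mu> \<nu> V}"
        using function_of_Q_in_multiplier_algebra[OF \<psi>' N] Sops[of "- l"] by blast
      ultimately show "\<exists>E\<in>{R o\<^sub>L M | R M. R \<in> bounded_ops \<and> M \<in> multiplier_algebra \<mu> \<nu> V}. \<forall>u.
          has_L1_limit_integral \<nu> (\<lambda>k. \<psi>' k *\<^sub>C blinfun_apply (S (- l) o\<^sub>L V k) u) (blinfun_apply E u)"
        by (intro bexI[of _ "S (- l) o\<^sub>L N"] allI)
    next
      fix u
      show "has_L1_limit_integral \<nu> (\<lambda>k. \<psi> k *\<^sub>C blinfun_apply (S (- k) o\<^sub>L V k) u)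
          (blinfun_apply (A o\<^sub>L T) u)"
        using has_L1_limit_integral_of_has_vector_integral[OF int[of "blinfun_apply T u"]]
        by (simp add: SV)
    qed
  qed
  show ?thesis
    unfolding decay_preserving_def
  proof (intro conjI ballI T)
    fix N assume N: "N \<in> multiplier_algebra \<mu> \<nu> V"
    show "T o\<^sub>L N \<in> B0_left \<mu> \<nu> W"
    proof (rule mem_closed_of_mem_closure[OF N[unfolded multiplier_algebra_def], where f="\<lambda>A. T o\<^sub>L A"])
      show "continuous_on UNIV (\<lambda>A. T o\<^sub>L A)" by (intro continuous_intros)
      show "closed (B0_left \<mu> \<nu> W :: ('h \<Rightarrow>\<^sub>L 'k) set)" by (simp add: B0_left_def)
    qed (use left in blast)
  next
    fix N assume N: "N \<in> multiplier_algebra \<mu> \<nu> W"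
    show "N o\<^sub>L T \<in> B0_right \<mu> \<nu> V"
    proof (rule mem_closed_of_mem_closure[OF N[unfolded multiplier_algebra_def], where f="\<lambda>A. A o\<^sub>L T"])
      show "continuous_on UNIV (\<lambda>A. A o\<^sub>L T)" by (intro continuous_intros)
      show "closed (B0_right \<mu> \<nu> V :: ('h \<Rightarrow>\<^sub>L 'k) set)" by (simp add: B0_right_def)
    qed (use right in blast)
  qed
qed

end
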